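(* If a Hermitian holomorphic vector bundle $E$ over $\mathbb D$ is homogeneous and is reducible as a Hermitian holomorphic vector bundle, $E=E_1\oplus E_2$ (orthogonal direct sum of Hermitian holomorphic sub-bundles), then it is reducible as a homogeneous Hermitian holomorphic vector bundle, that is, $E_1$ and $E_2$ are also homogeneous.
   Context: $\tilde G$ is the universal covering group of $G=\mathrm{SU}(1,1)$, acting on the unit disc $\mathbb D$ through the action of $G$ by M\"obius transformations $g\cdot z=(az+b)(\bar bz+\bar a)^{-1}$, $g=\begin{pmatrix}a&b\\ \bar b&\bar a\end{pmatrix}$. Vector bundles have finite rank. A Hermitian holomorphic vector bundle over $\mathbb D$ is homogeneous if $\tilde G$ acts on it by holomorphic, fibrewise linear and isometric bundle automorphisms covering the action on $\mathbb D$. The sub-bundles $E_1,E_2$ being homogeneous refers to the restriction of the $\tilde G$-action on $E$, i.e. they are preserved by it. *)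

theory Defs
  imports "HOL-Analysis.Analysis" "HOL-Complex_Analysis.Complex_Analysis" "HOL-Algebra.Group"
begin

section \<open>The group SU(1,1), its action on the disc, and its universal covering group\<close>

abbreviation unit_disc :: "complex set" where
  "unit_disc \<equiv> ball 0 1"

definition SU11 :: "(complex^2^2) set" where
  "SU11 = {A. A $ 2 $ 1 = cnj (A $ 1 $ 2) \<and> A $ 2 $ 2 = cnj (A $ 1 $ 1) \<and> det A = 1}"

definition SU11_group :: "(complex^2^2) monoid" where
  "SU11_group = \<lparr>carrier = SU11, mult = (**), one = mat 1\<rparr>"

definition disc_action :: "complex^2^2 \<Rightarrow> complex \<Rightarrow> complex" where
  "disc_action A = moebius (A $ 1 $ 1) (A $ 1 $ 2) (A $ 2 $ 1) (A $ 2 $ 2)"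

text \<open>
  The universal covering group is specified, up to isomorphism, by its defining property: a simply
  connected topological group together with a homomorphism onto SU(1,1) that is a covering map.
  The carrier has the subspace topology of the ambient type. The library notion
  \<^const>\<open>simply_connected\<close> includes path-connectedness.
\<close>

locale universal_covering_group_SU11 =
  fixes Gt :: "('g::topological_space) monoid" and p :: "'g \<Rightarrow> complex^2^2"
  assumes group_Gt: "group Gt"
    and continuous_mult: "continuous_on (carrier Gt \<times> carrier Gt) (\<lambda>(x, y). x \<otimes>\<^bsub>Gt\<^esub> y)"
    and continuous_inv: "continuous_on (carrier Gt) (\<lambda>x. inv\<^bsub>Gt\<^esub> x)"
    and hom_p: "p \<in> hom Gt SU11_group"
    and covering_p: "covering_space (carrier Gt) p SU11"
    and simply_connected_Gt: "simply_connected (carrier Gt)"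


section \<open>Smooth functions\<close>

text \<open>Meant for open \<open>S\<close>; the derivatives are those over the reals.\<close>

primrec Ck_on :: "nat \<Rightarrow> (complex \<Rightarrow> complex) \<Rightarrow> complex set \<Rightarrow> bool" where
  "Ck_on 0 f S \<longleftrightarrow> continuous_on S f"
| "Ck_on (Suc k) f S \<longleftrightarrow>
     (\<forall>x\<in>S. f differentiable (at x)) \<and> (\<forall>v. Ck_on k (\<lambda>x. frechet_derivative f (at x) v) S)"

definition Cinfinity_on :: "(complex \<Rightarrow> complex) \<Rightarrow> complex set \<Rightarrow> bool" where
  "Cinfinity_on f S \<longleftrightarrow> (\<forall>k. Ck_on k f S)"


section \<open>Hermitian holomorphic vector bundles over the unit disc\<close>

text \<open>
  The space of \<open>r\<close>-tuples of complex numbers is realised as the set of sequences vanishing from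
  index \<open>r\<close> on, so that bundles of different ranks have the same type.
\<close>

definition Cn :: "nat \<Rightarrow> (nat \<Rightarrow> complex) set" where
  "Cn r = {v. \<forall>i\<ge>r. v i = 0}"

definition unit_vec :: "nat \<Rightarrow> nat \<Rightarrow> complex" where
  "unit_vec j = (\<lambda>i. if i = j then 1 else 0)"

text \<open>
  The operations \<open>vadd\<close> and \<open>herm\<close> are meaningful only for two vectors in the same fibre. An element
  \<open>(U, \<phi>)\<close> of \<open>atlas\<close> is a local trivialisation over \<open>U\<close>, where \<open>\<phi>\<close> gives the fibre coordinates,
  that is, the trivialisation itself is \<open>e \<mapsto> (proj e, \<phi> e)\<close>.
\<close>

record 'e vbundle =
  Total :: "'e set"
  proj :: "'e \<Rightarrow> complex"
  vadd :: "'e \<Rightarrow> 'e \<Rightarrow> 'e"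
  vscale :: "complex \<Rightarrow> 'e \<Rightarrow> 'e"
  herm :: "'e \<Rightarrow> 'e \<Rightarrow> complex"
  rk :: nat
  atlas :: "(complex set \<times> ('e \<Rightarrow> nat \<Rightarrow> complex)) set"

definition fibre :: "'e vbundle \<Rightarrow> complex \<Rightarrow> 'e set" where
  "fibre E z = {e \<in> Total E. proj E e = z}"

definition frame :: "'e vbundle \<Rightarrow> ('e \<Rightarrow> nat \<Rightarrow> complex) \<Rightarrow> nat \<Rightarrow> complex \<Rightarrow> 'e" where
  "frame E \<phi> j z = inv_into (fibre E z) \<phi> (unit_vec j)"

text \<open>
  The vector space laws in the fibres are not listed, as they are inherited from \<open>Cn (rk E)\<close>
  through the fibrewise linear bijections \<open>\<phi>\<close>. The function that is holomorphic by
  \<open>transition_holomorphic\<close> is the entry \<open>(i, j)\<close> of the matrix of the change of trivialisation.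
  The metric is linear in its first argument; the zero vector of the fibre of \<open>e\<close> is \<open>vscale E 0 e\<close>.
\<close>

locale hermitian_holomorphic_bundle =
  fixes E :: "'e vbundle"
  assumes proj_in: "proj E ` Total E \<subseteq> unit_disc"
    and vadd_closed: "\<lbrakk>e \<in> fibre E z; f \<in> fibre E z\<rbrakk> \<Longrightarrow> vadd E e f \<in> fibre E z"
    and vscale_closed: "e \<in> fibre E z \<Longrightarrow> vscale E c e \<in> fibre E z"
    and atlas_open: "(U, \<phi>) \<in> atlas E \<Longrightarrow> open U"
    and atlas_cover: "(\<Union>(U, \<phi>)\<in>atlas E. U) = unit_disc"
    and triv_bij: "\<lbrakk>(U, \<phi>) \<in> atlas E; z \<in> U\<rbrakk> \<Longrightarrow> bij_betw \<phi> (fibre E z) (Cn (rk E))"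
    and triv_vadd: "\<lbrakk>(U, \<phi>) \<in> atlas E; z \<in> U; e \<in> fibre E z; f \<in> fibre E z\<rbrakk>
          \<Longrightarrow> \<phi> (vadd E e f) = (\<lambda>i. \<phi> e i + \<phi> f i)"
    and triv_vscale: "\<lbrakk>(U, \<phi>) \<in> atlas E; z \<in> U; e \<in> fibre E z\<rbrakk>
          \<Longrightarrow> \<phi> (vscale E c e) = (\<lambda>i. c * \<phi> e i)"
    and transition_holomorphic:
      "\<lbrakk>(U, \<phi>) \<in> atlas E; (V, \<psi>) \<in> atlas E; i < rk E; j < rk E\<rbrakk>
          \<Longrightarrow> (\<lambda>z. \<psi> (frame E \<phi> j z) i) holomorphic_on U \<inter> V"
    and herm_sym: "\<lbrakk>e \<in> fibre E z; f \<in> fibre E z\<rbrakk> \<Longrightarrow> herm E f e = cnj (herm E e f)"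
    and herm_add: "\<lbrakk>e \<in> fibre E z; e' \<in> fibre E z; f \<in> fibre E z\<rbrakk>
          \<Longrightarrow> herm E (vadd E e e') f = herm E e f + herm E e' f"
    and herm_scale: "\<lbrakk>e \<in> fibre E z; f \<in> fibre E z\<rbrakk>
          \<Longrightarrow> herm E (vscale E c e) f = c * herm E e f"
    and herm_pos: "\<lbrakk>e \<in> Total E; e \<noteq> vscale E 0 e\<rbrakk> \<Longrightarrow> 0 < Re (herm E e e)"
    and herm_smooth: "\<lbrakk>(U, \<phi>) \<in> atlas E; i < rk E; j < rk E\<rbrakk>
          \<Longrightarrow> Cinfinity_on (\<lambda>z. herm E (frame E \<phi> i z) (frame E \<phi> j z)) U"

text \<open>The topology of the total space for which the local trivialisations are homeomorphisms.\<close>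

definition bundle_topology :: "'e vbundle \<Rightarrow> 'e topology" where
  "bundle_topology E = topology_generated_by
     {{e \<in> Total E. proj E e \<in> U \<and> (proj E e, \<phi> e) \<in> W} | U \<phi> W. (U, \<phi>) \<in> atlas E \<and> open W}"

text \<open>
  Holomorphic bundle maps \<open>h\<close> from \<open>E\<close> to \<open>F\<close> covering a map \<open>f\<close> of the disc: since \<open>h\<close> is linear on
  fibres, it is holomorphic if and only if its matrix entries in local trivialisations are.
\<close>

definition holomorphic_bundle_map ::
    "'e vbundle \<Rightarrow> 'e vbundle \<Rightarrow> (complex \<Rightarrow> complex) \<Rightarrow> ('e \<Rightarrow> 'e) \<Rightarrow> bool" where
  "holomorphic_bundle_map E F f h \<longleftrightarrow>
     f holomorphic_on unit_disc \<and> f ` unit_disc \<subseteq> unit_disc \<and>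
     (\<forall>z\<in>unit_disc. \<forall>e\<in>fibre E z. h e \<in> fibre F (f z)) \<and>
     (\<forall>z\<in>unit_disc. \<forall>e\<in>fibre E z. \<forall>e'\<in>fibre E z. h (vadd E e e') = vadd F (h e) (h e')) \<and>
     (\<forall>z\<in>unit_disc. \<forall>e\<in>fibre E z. \<forall>c. h (vscale E c e) = vscale F c (h e)) \<and>
     (\<forall>(U, \<phi>)\<in>atlas E. \<forall>(V, \<psi>)\<in>atlas F. \<forall>i<rk F. \<forall>j<rk E.
        (\<lambda>z. \<psi> (h (frame E \<phi> j z)) i) holomorphic_on {z \<in> U. f z \<in> V})"

text \<open>
  A sub-bundle carries its own holomorphic structure, and the (fibrewise injective) inclusion has to
  be a holomorphic bundle map over the identity; its metric is the restricted one.
\<close>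

definition hermitian_holomorphic_subbundle :: "'e vbundle \<Rightarrow> 'e vbundle \<Rightarrow> bool" where
  "hermitian_holomorphic_subbundle F E \<longleftrightarrow>
     hermitian_holomorphic_bundle F \<and> Total F \<subseteq> Total E \<and>
     holomorphic_bundle_map F E (\<lambda>z. z) (\<lambda>e. e) \<and>
     (\<forall>z\<in>unit_disc. \<forall>e\<in>fibre F z. \<forall>f\<in>fibre F z. herm F e f = herm E e f)"

definition orthogonal_direct_sum :: "'e vbundle \<Rightarrow> 'e vbundle \<Rightarrow> 'e vbundle \<Rightarrow> bool" where
  "orthogonal_direct_sum E E1 E2 \<longleftrightarrow>
     hermitian_holomorphic_subbundle E1 E \<and> hermitian_holomorphic_subbundle E2 E \<and>
     (\<forall>z\<in>unit_disc.
        bij_betw (\<lambda>(e1, e2). vadd E e1 e2) (fibre E1 z \<times> fibre E2 z) (fibre E z) \<and>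
        (\<forall>e1\<in>fibre E1 z. \<forall>e2\<in>fibre E2 z. herm E e1 e2 = 0))"

definition reducible_as :: "'e vbundle \<Rightarrow> 'e vbundle \<Rightarrow> 'e vbundle \<Rightarrow> bool" where
  "reducible_as E E1 E2 \<longleftrightarrow> 0 < rk E1 \<and> 0 < rk E2 \<and> orthogonal_direct_sum E E1 E2"


section \<open>Homogeneous bundles\<close>

text \<open>
  The Hermitian holomorphic bundle \<open>E\<close> is homogeneous by means of the action \<open>act\<close> of the covering
  group \<open>Gt\<close>, where \<open>p\<close> is the covering homomorphism. As usual for topological groups, actions are
  continuous. Every \<open>act g\<close> is an automorphism, with inverse the action of the inverse of \<open>g\<close>.
  Only the values of \<open>act\<close> on \<open>Total E\<close> matter, so for a sub-bundle \<open>F\<close> of \<open>E\<close> the condition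
  with \<open>F\<close> in place of \<open>E\<close> refers to the restricted action and says in particular that \<open>F\<close>
  is preserved.
\<close>

locale homogeneous_bundle = hermitian_holomorphic_bundle E
  for Gt :: "('g::topological_space) monoid" and p :: "'g \<Rightarrow> complex^2^2"
    and act :: "'g \<Rightarrow> 'e \<Rightarrow> 'e" and E :: "'e vbundle" +
  assumes act_one: "e \<in> Total E \<Longrightarrow> act \<one>\<^bsub>Gt\<^esub> e = e"
    and act_mult: "\<lbrakk>g \<in> carrier Gt; h \<in> carrier Gt; e \<in> Total E\<rbrakk>
          \<Longrightarrow> act (g \<otimes>\<^bsub>Gt\<^esub> h) e = act g (act h e)"
    and act_holomorphic: "g \<in> carrier Gt
          \<Longrightarrow> holomorphic_bundle_map E E (disc_action (p g)) (act g)"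
    and act_isometric: "\<lbrakk>g \<in> carrier Gt; e \<in> fibre E z; f \<in> fibre E z\<rbrakk>
          \<Longrightarrow> herm E (act g e) (act g f) = herm E e f"
    and act_continuous: "continuous_map
          (prod_topology (top_of_set (carrier Gt)) (bundle_topology E)) (bundle_topology E)
          (\<lambda>(g, e). act g e)"

end

theory Submission
  imports Defs
begin

text \<open>
  Let \<open>P\<close> be the orthogonal projection of \<open>E\<close> onto \<open>E1\<close>. It is a holomorphic
  endomorphism of \<open>E\<close> over the identity and it is self-adjoint; \<open>E1\<close> is preserved by \<open>g\<close> as soon as
  \<open>P\<close> commutes with the action of \<open>g\<close>. The claim is therefore a special case of
  \<open>endomorphism_commutes_with_action\<close>: every self-adjoint holomorphic endomorphism \<open>P\<close> of a homogeneous
  bundle commutes with the action.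

  For \<open>g\<close> in the group, \<open>P\<^sub>g = g P g\<^sup>-\<^sup>1\<close> (called \<open>twist g\<close>) is again a self-adjoint holomorphic
  endomorphism over the identity. The function \<open>z \<mapsto> tr (P\<^sub>g P\<^sub>h)\<close> on the disc is holomorphic, because the
  entries of both matrices are, and real, because both operators are self-adjoint; so it is constant
  (\<open>corr_constant\<close>). Hence the Hilbert-Schmidt distance \<open>d(g, h)\<close> of \<open>P\<^sub>g\<close> and \<open>P\<^sub>h\<close> can be computed in any
  fibre, it vanishes only if \<open>P\<^sub>g = P\<^sub>h\<close> everywhere, and it is invariant under left translation of
  \<open>g\<close> and \<open>h\<close> (\<open>corr_translate\<close>). Observed in a single fibre, the \<open>P\<^sub>g\<close> form a bounded set of matrices.
  So \<open>d\<close> is a continuous, left invariant and totally bounded pseudometric on the group: the group acts on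
  the orbit of \<open>P\<close> as on a subset of a Euclidean space, through a compact group of isometries.

  A noncompact simple group admits no such action that is not trivial. Concretely, total boundedness
  makes the powers of every \<open>a\<close> return close to the identity with respect to \<open>d\<close>
  (\<open>power_recurrence\<close>). If \<open>a\<^sup>-\<^sup>n u a\<^sup>n\<close> converges to the identity, then
  \<open>d(u, 1) \<le> 2 d(a\<^sup>n, 1) + d(a\<^sup>-\<^sup>n u a\<^sup>n, 1)\<close> is arbitrarily small along suitable \<open>n\<close>, hence \<open>u\<close> commutes with
  \<open>P\<close> (\<open>contracted_gdist_zero\<close>). The unipotent elements of \<open>SU(1,1)\<close> are contracted in this way by
  diagonalisable ones, and so are their lifts close to the identity; products of four of these fill a
  neighbourhood of the identity, and the covering group is connected
  (\<open>contracted_elements_generate\<close>).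

  That the restricted action on \<open>E1\<close> is again holomorphic and continuous for the structure of \<open>E1\<close> itself
  follows by writing it as inclusion, action on \<open>E\<close> and projection \<open>E \<rightarrow> E1\<close>, all of which are
  holomorphic bundle maps.
\<close>


section \<open>Coordinates, linear maps and traces on fibres\<close>

definition fibre_coords :: "'e vbundle \<Rightarrow> complex \<Rightarrow> ('e \<Rightarrow> nat \<Rightarrow> complex) \<Rightarrow> bool" where
  "fibre_coords E z \<psi> \<longleftrightarrow>
     bij_betw \<psi> (fibre E z) (Cn (rk E)) \<and>
     (\<forall>e\<in>fibre E z. \<forall>f\<in>fibre E z. \<psi> (vadd E e f) = (\<lambda>i. \<psi> e i + \<psi> f i)) \<and>
     (\<forall>e\<in>fibre E z. \<forall>c. \<psi> (vscale E c e) = (\<lambda>i. c * \<psi> e i))"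

definition fibre_linear ::
    "'e vbundle \<Rightarrow> 'e vbundle \<Rightarrow> complex \<Rightarrow> complex \<Rightarrow> ('e \<Rightarrow> 'e) \<Rightarrow> bool" where
  "fibre_linear E F z w h \<longleftrightarrow>
     (\<forall>e\<in>fibre E z. h e \<in> fibre F w) \<and>
     (\<forall>e\<in>fibre E z. \<forall>f\<in>fibre E z. h (vadd E e f) = vadd F (h e) (h f)) \<and>
     (\<forall>e\<in>fibre E z. \<forall>c. h (vscale E c e) = vscale F c (h e))"

lemma fibre_coordsD:
  assumes "fibre_coords E z \<psi>"
  shows "bij_betw \<psi> (fibre E z) (Cn (rk E))"
    and "\<And>e f. \<lbrakk>e \<in> fibre E z; f \<in> fibre E z\<rbrakk> \<Longrightarrow> \<psi> (vadd E e f) = (\<lambda>i. \<psi> e i + \<psi> f i)"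
    and "\<And>e c. e \<in> fibre E z \<Longrightarrow> \<psi> (vscale E c e) = (\<lambda>i. c * \<psi> e i)"
  using assms by (auto simp: fibre_coords_def)

lemma fibre_coords_inj:
  "\<lbrakk>fibre_coords E z \<psi>; e \<in> fibre E z; f \<in> fibre E z; \<psi> e = \<psi> f\<rbrakk> \<Longrightarrow> e = f"
  using fibre_coordsD(1) by (metis bij_betw_imp_inj_on inj_onD)

lemma fibre_coords_Cn: "\<lbrakk>fibre_coords E z \<psi>; e \<in> fibre E z\<rbrakk> \<Longrightarrow> \<psi> e \<in> Cn (rk E)"
  using fibre_coordsD(1) bij_betwE by blast

lemma fibre_coords_zero_beyond: "\<lbrakk>fibre_coords E z \<psi>; e \<in> fibre E z; rk E \<le> i\<rbrakk> \<Longrightarrow> \<psi> e i = 0"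
  using fibre_coords_Cn by (fastforce simp: Cn_def)

lemma chart_coords:
  assumes "hermitian_holomorphic_bundle E" "(U, \<phi>) \<in> atlas E" "z \<in> U"
  shows "fibre_coords E z \<phi>"
  using assms hermitian_holomorphic_bundle.triv_bij hermitian_holomorphic_bundle.triv_vadd
    hermitian_holomorphic_bundle.triv_vscale
  unfolding fibre_coords_def by meson

lemma fibre_linearD:
  assumes "fibre_linear E F z w h"
  shows "\<And>e. e \<in> fibre E z \<Longrightarrow> h e \<in> fibre F w"
    and "\<And>e f. \<lbrakk>e \<in> fibre E z; f \<in> fibre E z\<rbrakk> \<Longrightarrow> h (vadd E e f) = vadd F (h e) (h f)"
    and "\<And>e c. e \<in> fibre E z \<Longrightarrow> h (vscale E c e) = vscale F c (h e)"
  using assms by (auto simp: fibre_linear_def)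

lemma fibre_linear_compose:
  "\<lbrakk>fibre_linear E F z w h; fibre_linear F G w u k\<rbrakk> \<Longrightarrow> fibre_linear E G z u (\<lambda>e. k (h e))"
  by (auto simp: fibre_linear_def)

lemma unit_vec_in_Cn: "j < r \<Longrightarrow> unit_vec j \<in> Cn r"
  by (auto simp: Cn_def unit_vec_def)

lemma frame_coords:
  assumes "fibre_coords E z \<phi>" "j < rk E"
  shows "frame E \<phi> j z \<in> fibre E z" "\<phi> (frame E \<phi> j z) = unit_vec j"
proof -
  have "unit_vec j \<in> \<phi> ` fibre E z"
    using fibre_coordsD(1)[OF assms(1)] unit_vec_in_Cn[OF assms(2)] by (simp add: bij_betw_def)
  then show "frame E \<phi> j z \<in> fibre E z" "\<phi> (frame E \<phi> j z) = unit_vec j"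
    by (auto simp: frame_def inv_into_into f_inv_into_f)
qed

text \<open>
  The expansion of a vector in a frame is stated through its values under a linear functional \<open>L\<close>, so
  that no sum of a family of vectors of the fibre has to be formed. It is proved by removing one
  coordinate of \<open>e\<close> after the other.
\<close>

lemma linear_functional_expansion:
  fixes L :: "'e \<Rightarrow> complex"
  assumes E: "hermitian_holomorphic_bundle E" and \<phi>: "fibre_coords E z \<phi>"
    and L_add: "\<And>e f. \<lbrakk>e \<in> fibre E z; f \<in> fibre E z\<rbrakk> \<Longrightarrow> L (vadd E e f) = L e + L f"
    and L_scale: "\<And>e c. e \<in> fibre E z \<Longrightarrow> L (vscale E c e) = c * L e"
    and e: "e \<in> fibre E z"
  shows "L e = (\<Sum>j<rk E. \<phi> e j * L (frame E \<phi> j z))"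
proof -
  interpret hermitian_holomorphic_bundle E by (rule E)
  have "L e = (\<Sum>j<k. \<phi> e j * L (frame E \<phi> j z))"
    if "k \<le> rk E" "e \<in> fibre E z" "\<phi> e \<in> Cn k" for k e
    using that
  proof (induction k arbitrary: e)
    case 0
    have "\<phi> (vscale E 0 e) = \<phi> e"
      using 0 fibre_coordsD(3)[OF \<phi>] by (auto simp: Cn_def)
    then have "vscale E 0 e = e"
      using fibre_coords_inj[OF \<phi>] 0 vscale_closed by blast
    then show ?case
      using L_scale[of e 0] 0 by auto
  next
    case (Suc k)
    let ?b = "frame E \<phi> k z"
    define e' where "e' = vadd E e (vscale E (- \<phi> e k) ?b)"
    have b: "?b \<in> fibre E z" "\<phi> ?b = unit_vec k"
      using frame_coords[OF \<phi>, of k] Suc.prems by auto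
    have sb: "vscale E (- \<phi> e k) ?b \<in> fibre E z"
      using b vscale_closed by blast
    have e': "e' \<in> fibre E z"
      unfolding e'_def using vadd_closed Suc.prems sb by blast
    have "\<phi> e' = (\<lambda>i. \<phi> e i - \<phi> e k * unit_vec k i)"
      unfolding e'_def using fibre_coordsD(2)[OF \<phi> Suc.prems(2) sb] fibre_coordsD(3)[OF \<phi> b(1)] b(2)
      by auto
    then have coord: "\<phi> e' i = (if i = k then 0 else \<phi> e i)" for i
      by (auto simp: unit_vec_def)
    have "\<phi> e' \<in> Cn k"
      using Suc.prems(3) by (auto simp: Cn_def coord)
    then have "L e' = (\<Sum>j<k. \<phi> e' j * L (frame E \<phi> j z))"
      using Suc.IH e' Suc.prems(1) by simp
    also have "\<dots> = (\<Sum>j<k. \<phi> e j * L (frame E \<phi> j z))"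
      by (intro sum.cong) (auto simp: coord)
    finally have "L e' = (\<Sum>j<k. \<phi> e j * L (frame E \<phi> j z))" .
    moreover have "L e' = L e - \<phi> e k * L ?b"
      unfolding e'_def using L_add[OF Suc.prems(2) sb] L_scale[OF b(1)] by simp
    ultimately show ?case
      by (simp add: algebra_simps)
  qed
  then show ?thesis
    using e fibre_coords_Cn[OF \<phi> e] by blast
qed

lemma coords_linear_expansion:
  assumes E: "hermitian_holomorphic_bundle E" and \<phi>: "fibre_coords E z \<phi>"
    and \<psi>: "fibre_coords F w \<psi>" and h: "fibre_linear E F z w h" and e: "e \<in> fibre E z"
  shows "\<psi> (h e) i = (\<Sum>j<rk E. \<phi> e j * \<psi> (h (frame E \<phi> j z)) i)"
  by (rule linear_functional_expansion[OF E \<phi> _ _ e])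
    (simp_all add: fibre_linearD[OF h] fibre_coordsD[OF \<psi>])

definition fibre_trace :: "'e vbundle \<Rightarrow> complex \<Rightarrow> ('e \<Rightarrow> nat \<Rightarrow> complex) \<Rightarrow> ('e \<Rightarrow> 'e) \<Rightarrow> complex" where
  "fibre_trace E z \<phi> T = (\<Sum>j<rk E. \<phi> (T (frame E \<phi> j z)) j)"

lemma fibre_trace_cong:
  assumes "fibre_coords E z \<phi>" "\<And>e. e \<in> fibre E z \<Longrightarrow> S e = T e"
  shows "fibre_trace E z \<phi> S = fibre_trace E z \<phi> T"
  unfolding fibre_trace_def by (intro sum.cong) (auto simp: frame_coords[OF assms(1)] assms(2))

text \<open>
  The identity \<open>tr (Y X) = tr (X Y)\<close>, for maps between possibly different fibres. It contains both
  the independence of the trace of the coordinates (\<open>Y\<close> the identity) and its invariance under a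
  bundle automorphism (\<open>Y\<close> the composite of an endomorphism with the inverse of \<open>X\<close>).
\<close>

lemma fibre_trace_commute:
  assumes E: "hermitian_holomorphic_bundle E" and F: "hermitian_holomorphic_bundle F"
    and \<phi>: "fibre_coords E z \<phi>" and \<psi>: "fibre_coords F w \<psi>"
    and X: "fibre_linear E F z w X" and Y: "fibre_linear F E w z Y"
  shows "fibre_trace E z \<phi> (\<lambda>e. Y (X e)) = fibre_trace F w \<psi> (\<lambda>e. X (Y e))"
proof -
  let ?e = "\<lambda>j. frame E \<phi> j z" and ?f = "\<lambda>j. frame F \<psi> j w"
  have "fibre_trace E z \<phi> (\<lambda>e. Y (X e))
      = (\<Sum>j<rk E. \<Sum>i<rk F. \<psi> (X (?e j)) i * \<phi> (Y (?f i)) j)"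
    unfolding fibre_trace_def
    by (intro sum.cong refl coords_linear_expansion[OF F \<psi> \<phi> Y])
      (simp add: fibre_linearD(1)[OF X] frame_coords[OF \<phi>])
  also have "\<dots> = (\<Sum>i<rk F. \<Sum>j<rk E. \<phi> (Y (?f i)) j * \<psi> (X (?e j)) i)"
    by (subst sum.swap) (simp add: mult.commute)
  also have "\<dots> = fibre_trace F w \<psi> (\<lambda>e. X (Y e))"
    unfolding fibre_trace_def
    by (intro sum.cong refl coords_linear_expansion[OF E \<phi> \<psi> X, symmetric])
      (simp add: fibre_linearD(1)[OF Y] frame_coords[OF \<psi>])
  finally show ?thesis .
qed

lemma fibre_trace_coords_independent:
  assumes E: "hermitian_holomorphic_bundle E"
    and \<phi>: "fibre_coords E z \<phi>" and \<psi>: "fibre_coords E z \<psi>" and T: "fibre_linear E E z z T"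
  shows "fibre_trace E z \<phi> T = fibre_trace E z \<psi> T"
proof -
  have id: "fibre_linear E E z z (\<lambda>e. e)" by (auto simp: fibre_linear_def)
  show ?thesis using fibre_trace_commute[OF E E \<phi> \<psi> T id] by simp
qed


section \<open>Orthonormal coordinates\<close>

definition positive_hermitian_form ::
    "nat \<Rightarrow> ((nat \<Rightarrow> complex) \<Rightarrow> (nat \<Rightarrow> complex) \<Rightarrow> complex) \<Rightarrow> bool" where
  "positive_hermitian_form r H \<longleftrightarrow>
     (\<forall>u\<in>Cn r. \<forall>v\<in>Cn r. \<forall>w\<in>Cn r. H (\<lambda>i. u i + v i) w = H u w + H v w) \<and>
     (\<forall>u\<in>Cn r. \<forall>v\<in>Cn r. \<forall>c. H (\<lambda>i. c * u i) v = c * H u v) \<and>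
     (\<forall>u\<in>Cn r. \<forall>v\<in>Cn r. H v u = cnj (H u v)) \<and>
     (\<forall>u\<in>Cn r. u \<noteq> (\<lambda>i. 0) \<longrightarrow> 0 < Re (H u u))"

text \<open>
  Gram-Schmidt by induction on \<open>r\<close>: for the last basis vector \<open>b\<close>, the orthogonal projection \<open>q\<close> along \<open>b\<close> is
  injective on \<open>Cn r\<close>, so the induction hypothesis applies to the form \<open>H (q u) (q v)\<close> on \<open>Cn r\<close>; the
  coordinate that is added is the inner product with the normalised vector \<open>b\<close>.
\<close>

lemma gram_schmidt_Cn:
  assumes "positive_hermitian_form r H"
  obtains B where "bij_betw B (Cn r) (Cn r)"
    and "\<And>u v. \<lbrakk>u \<in> Cn r; v \<in> Cn r\<rbrakk> \<Longrightarrow> B (\<lambda>i. u i + v i) = (\<lambda>i. B u i + B v i)"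
    and "\<And>u c. u \<in> Cn r \<Longrightarrow> B (\<lambda>i. c * u i) = (\<lambda>i. c * B u i)"
    and "\<And>u v. \<lbrakk>u \<in> Cn r; v \<in> Cn r\<rbrakk> \<Longrightarrow> H u v = (\<Sum>i<r. B u i * cnj (B v i))"
proof -
  have "\<exists>B. B ` Cn r = Cn r \<and>
     (\<forall>u\<in>Cn r. \<forall>v\<in>Cn r. B (\<lambda>i. u i + v i) = (\<lambda>i. B u i + B v i)) \<and>
     (\<forall>u\<in>Cn r. \<forall>c. B (\<lambda>i. c * u i) = (\<lambda>i. c * B u i)) \<and>
     (\<forall>u\<in>Cn r. \<forall>v\<in>Cn r. H u v = (\<Sum>i<r. B u i * cnj (B v i)))"
    using assms
  proof (induction r arbitrary: H)
    case 0
    have "H (\<lambda>i. 0) (\<lambda>i. 0) = 0"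
    proof -
      have z: "(\<lambda>i. 0) \<in> Cn 0" by (simp add: Cn_def)
      have "\<forall>u\<in>Cn 0. \<forall>v\<in>Cn 0. \<forall>c. H (\<lambda>i. c * u i) v = c * H u v"
        using 0 unfolding positive_hermitian_form_def by blast
      from this[THEN bspec, OF z, THEN bspec, OF z, THEN spec, of 0] show ?thesis by simp
    qed
    moreover have "Cn 0 = {\<lambda>i. 0}" by (auto simp: Cn_def)
    ultimately show ?case by (intro exI[of _ "\<lambda>u. u"]) auto
  next
    case (Suc r)
    have add: "\<And>u v w. \<lbrakk>u \<in> Cn (Suc r); v \<in> Cn (Suc r); w \<in> Cn (Suc r)\<rbrakk>
        \<Longrightarrow> H (\<lambda>i. u i + v i) w = H u w + H v w"
      and scale: "\<And>u v c. \<lbrakk>u \<in> Cn (Suc r); v \<in> Cn (Suc r)\<rbrakk> \<Longrightarrow> H (\<lambda>i. c * u i) v = c * H u v"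
      and sym: "\<And>u v. \<lbrakk>u \<in> Cn (Suc r); v \<in> Cn (Suc r)\<rbrakk> \<Longrightarrow> H v u = cnj (H u v)"
      and pos: "\<And>u. \<lbrakk>u \<in> Cn (Suc r); u \<noteq> (\<lambda>i. 0)\<rbrakk> \<Longrightarrow> 0 < Re (H u u)"
      using Suc.prems unfolding positive_hermitian_form_def by blast+
    define b where "b = unit_vec r"
    have b: "b \<in> Cn (Suc r)" "b r = 1" "b \<noteq> (\<lambda>i. 0)"
      by (auto simp: b_def Cn_def unit_vec_def fun_eq_iff)
    have bi: "b i = (if i = r then 1 else 0)" for i by (simp add: b_def unit_vec_def)
    define a where "a = Re (H b b)"
    have a: "a > 0" "H b b = of_real a"
      using pos[OF b(1,3)] sym[OF b(1,1)] by (auto simp: a_def complex_eq_iff)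
    have Cn_add: "(\<lambda>i. u i + v i) \<in> Cn k" if "u \<in> Cn k" "v \<in> Cn k" for u v k
      using that by (auto simp: Cn_def)
    have Cn_scale: "(\<lambda>i. c * u i) \<in> Cn k" if "u \<in> Cn k" for u c k
      using that by (auto simp: Cn_def)
    have Cn_mono: "u \<in> Cn (Suc r)" if "u \<in> Cn r" for u
      using that by (auto simp: Cn_def)
    have add2: "H w (\<lambda>i. u i + v i) = H w u + H w v"
      if "u \<in> Cn (Suc r)" "v \<in> Cn (Suc r)" "w \<in> Cn (Suc r)" for u v w
      using sym[OF Cn_add[OF that(1,2)] that(3)] add[OF that] sym[OF that(1,3)] sym[OF that(2,3)] by simp
    have scale2: "H w (\<lambda>i. c * u i) = cnj c * H w u"
      if "u \<in> Cn (Suc r)" "w \<in> Cn (Suc r)" for u w c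
      using sym[OF Cn_scale[OF that(1)] that(2), of c] scale[OF that, of c] sym[OF that] by simp
    \<comment> \<open>the component of \<open>u\<close> orthogonal to \<open>b\<close>\<close>
    define q where "q u = (\<lambda>i. u i + (- (H u b / a)) * b i)" for u
    have q_in: "q u \<in> Cn (Suc r)" if "u \<in> Cn (Suc r)" for u
      unfolding q_def by (intro Cn_add Cn_scale that b)
    have Hqq: "H (q u) (q v) = H u v - H u b * H b v / a"
      if u: "u \<in> Cn (Suc r)" and v: "v \<in> Cn (Suc r)" for u v
    proof -
      have "H (q u) (q v) = H u (q v) - H u b / a * H b (q v)"
        unfolding q_def[of u] using add[OF u Cn_scale[OF b(1)] q_in[OF v], of "- (H u b / a)"]
          scale[OF b(1) q_in[OF v], of "- (H u b / a)"] by simp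
      moreover have "H w (q v) = H w v - cnj (H v b / a) * H w b" if "w \<in> Cn (Suc r)" for w
        unfolding q_def using add2[OF v Cn_scale[OF b(1)] that, of "- (H v b / a)"]
          scale2[OF b(1) that, of "- (H v b / a)"] by simp
      moreover have "cnj (H v b) = H b v" using sym[OF v b(1)] by simp
      ultimately show ?thesis using u b(1) a by (simp add: field_simps)
    qed
    have q_add: "q (\<lambda>i. u i + v i) = (\<lambda>i. q u i + q v i)"
      if "u \<in> Cn (Suc r)" "v \<in> Cn (Suc r)" for u v
      unfolding q_def using add[OF that b(1)] by (simp add: add_divide_distrib algebra_simps)
    have q_scale: "q (\<lambda>i. c * u i) = (\<lambda>i. c * q u i)" if "u \<in> Cn (Suc r)" for u c
      unfolding q_def using scale[OF that b(1)] by (auto simp: field_simps)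
    have q_nz: "q u \<noteq> (\<lambda>i. 0)" if u: "u \<in> Cn r" "u \<noteq> (\<lambda>i. 0)" for u
    proof -
      obtain i where "u i \<noteq> 0" using u by blast
      then have "i \<noteq> r" using u(1) by (auto simp: Cn_def)
      then have "q u i = u i" by (simp add: q_def bi)
      with \<open>u i \<noteq> 0\<close> show ?thesis by auto
    qed
    have "\<exists>B. B ` Cn r = Cn r \<and>
     (\<forall>u\<in>Cn r. \<forall>v\<in>Cn r. B (\<lambda>i. u i + v i) = (\<lambda>i. B u i + B v i)) \<and>
     (\<forall>u\<in>Cn r. \<forall>c. B (\<lambda>i. c * u i) = (\<lambda>i. c * B u i)) \<and>
     (\<forall>u\<in>Cn r. \<forall>v\<in>Cn r. H (q u) (q v) = (\<Sum>i<r. B u i * cnj (B v i)))"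
    proof (rule Suc.IH, unfold positive_hermitian_form_def, intro conjI ballI allI impI)
      fix u v w assume *: "u \<in> Cn r" "v \<in> Cn r" "w \<in> Cn r"
      show "H (q (\<lambda>i. u i + v i)) (q w) = H (q u) (q w) + H (q v) (q w)"
        using q_add[of u v] add[of "q u" "q v" "q w"] q_in Cn_mono * by simp
    next
      fix u v c assume *: "u \<in> Cn r" "v \<in> Cn r"
      show "H (q (\<lambda>i. c * u i)) (q v) = c * H (q u) (q v)"
        using q_scale[of u c] scale[of "q u" "q v"] q_in Cn_mono * by simp
    next
      fix u v assume *: "u \<in> Cn r" "v \<in> Cn r"
      show "H (q v) (q u) = cnj (H (q u) (q v))"
        using sym q_in Cn_mono * by blast
    next
      fix u :: "nat \<Rightarrow> complex" assume *: "u \<in> Cn r" "u \<noteq> (\<lambda>i. 0)"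
      show "0 < Re (H (q u) (q u))"
        using pos q_in Cn_mono q_nz * by blast
    qed
    then obtain B where B_im: "B ` Cn r = Cn r"
      and B_add: "\<And>u v. \<lbrakk>u \<in> Cn r; v \<in> Cn r\<rbrakk> \<Longrightarrow> B (\<lambda>i. u i + v i) = (\<lambda>i. B u i + B v i)"
      and B_scale: "\<And>u c. u \<in> Cn r \<Longrightarrow> B (\<lambda>i. c * u i) = (\<lambda>i. c * B u i)"
      and B_H: "\<And>u v. \<lbrakk>u \<in> Cn r; v \<in> Cn r\<rbrakk> \<Longrightarrow> H (q u) (q v) = (\<Sum>i<r. B u i * cnj (B v i))"
      by blast
    define t where "t u = u(r := 0)" for u :: "nat \<Rightarrow> complex"
    have t_in: "t u \<in> Cn r" if "u \<in> Cn (Suc r)" for u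
      using that by (auto simp: t_def Cn_def)
    have t_add: "t (\<lambda>i. u i + v i) = (\<lambda>i. t u i + t v i)" for u v by (auto simp: t_def)
    have t_scale: "t (\<lambda>i. c * u i) = (\<lambda>i. c * t u i)" for u c by (auto simp: t_def)
    have u_eq: "u = (\<lambda>i. t u i + u r * b i)" for u by (auto simp: t_def bi)
    have q_t: "q (t u) = q u" if u: "u \<in> Cn (Suc r)" for u
    proof -
      have "q u = q (\<lambda>i. t u i + u r * b i)" using u_eq[of u] by simp
      also have "\<dots> = (\<lambda>i. q (t u) i + u r * q b i)"
        using q_add[OF Cn_mono[OF t_in[OF u]] Cn_scale[OF b(1)], of "u r"] q_scale[OF b(1), of "u r"]
        by simp
      also have "q b = (\<lambda>i. 0)" using a by (simp add: q_def)
      finally show ?thesis by simp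
    qed
    define C where "C u = (B (t u))(r := H u b / sqrt a)" for u
    have C_in: "C u \<in> Cn (Suc r)" if "u \<in> Cn (Suc r)" for u
    proof -
      have "B (t u) \<in> Cn r" using B_im t_in[OF that] by blast
      then show ?thesis by (auto simp: C_def Cn_def)
    qed
    have sq: "complex_of_real (sqrt a) * complex_of_real (sqrt a) = a" "sqrt a \<noteq> 0"
      using a by (simp_all flip: of_real_mult)
    have "C ` Cn (Suc r) = Cn (Suc r)"
    proof (intro equalityI subsetI)
      fix w :: "nat \<Rightarrow> complex" assume w: "w \<in> Cn (Suc r)"
      obtain v where v: "v \<in> Cn r" "B v = t w" using B_im t_in[OF w] by (metis imageE)
      define c where "c = (sqrt a * w r - H v b) / a"
      let ?u = "\<lambda>i. v i + c * b i"
      have u: "?u \<in> Cn (Suc r)" by (intro Cn_add Cn_scale b Cn_mono v)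
      have "t ?u = v" using v by (auto simp: t_def bi Cn_def)
      moreover have "H ?u b = sqrt a * w r"
        using add[OF Cn_mono[OF v(1)] Cn_scale[OF b(1)] b(1), of c] scale[OF b(1) b(1), of c] a
        by (simp add: c_def)
      ultimately have "C ?u = w" using sq v by (auto simp: C_def t_def)
      then show "w \<in> C ` Cn (Suc r)" using u by blast
    qed (use C_in in blast)
    moreover have "C (\<lambda>i. u i + v i) = (\<lambda>i. C u i + C v i)"
      if "u \<in> Cn (Suc r)" "v \<in> Cn (Suc r)" for u v
      using add[OF that b(1)] B_add[OF t_in[OF that(1)] t_in[OF that(2)]]
      by (auto simp: C_def t_add add_divide_distrib)
    moreover have "C (\<lambda>i. c * u i) = (\<lambda>i. c * C u i)" if "u \<in> Cn (Suc r)" for u c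
      using scale[OF that b(1)] B_scale[OF t_in[OF that]] by (auto simp: C_def t_scale)
    moreover have "H u v = (\<Sum>i<Suc r. C u i * cnj (C v i))"
      if u: "u \<in> Cn (Suc r)" and v: "v \<in> Cn (Suc r)" for u v
    proof -
      have "(\<Sum>i<Suc r. C u i * cnj (C v i))
          = (\<Sum>i<r. B (t u) i * cnj (B (t v) i)) + H u b * cnj (H v b) / a"
        using sq by (simp add: C_def)
      also have "\<dots> = H (q u) (q v) + H u b * H b v / a"
        using B_H[OF t_in[OF u] t_in[OF v]] q_t u v sym[OF v b(1)] by simp
      finally show ?thesis using Hqq[OF u v] by simp
    qed
    ultimately show ?case by blast
  qed
  then obtain B where B: "B ` Cn r = Cn r"
     "\<And>u v. \<lbrakk>u \<in> Cn r; v \<in> Cn r\<rbrakk> \<Longrightarrow> B (\<lambda>i. u i + v i) = (\<lambda>i. B u i + B v i)"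
     "\<And>u c. u \<in> Cn r \<Longrightarrow> B (\<lambda>i. c * u i) = (\<lambda>i. c * B u i)"
     "\<And>u v. \<lbrakk>u \<in> Cn r; v \<in> Cn r\<rbrakk> \<Longrightarrow> H u v = (\<Sum>i<r. B u i * cnj (B v i))"
    by blast
  have "inj_on B (Cn r)"
  proof (rule inj_onI)
    fix u v assume u: "u \<in> Cn r" and v: "v \<in> Cn r" and eq: "B u = B v"
    let ?d = "\<lambda>i. u i + (- 1) * v i"
    have mv: "(\<lambda>i. (- 1) * v i) \<in> Cn r" and d: "?d \<in> Cn r" using u v by (auto simp: Cn_def)
    have "B ?d = (\<lambda>i. 0)" using B(2)[OF u mv] B(3)[OF v, of "- 1"] eq by auto
    then have "H ?d ?d = 0" using B(4)[OF d d] by simp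
    moreover have "?d \<noteq> (\<lambda>i. 0) \<longrightarrow> 0 < Re (H ?d ?d)"
      using assms[unfolded positive_hermitian_form_def] d by blast
    ultimately have "?d = (\<lambda>i. 0)" by fastforce
    then show "u = v" by (auto simp: fun_eq_iff)
  qed
  with B show ?thesis by (intro that[of B]) (auto simp: bij_betw_def)
qed

definition orthonormal_coords :: "'e vbundle \<Rightarrow> complex \<Rightarrow> ('e \<Rightarrow> nat \<Rightarrow> complex) \<Rightarrow> bool" where
  "orthonormal_coords E z \<psi> \<longleftrightarrow> fibre_coords E z \<psi> \<and>
     (\<forall>e\<in>fibre E z. \<forall>f\<in>fibre E z. herm E e f = (\<Sum>i<rk E. \<psi> e i * cnj (\<psi> f i)))"

lemma chart_at:
  assumes "hermitian_holomorphic_bundle E" "z \<in> unit_disc"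
  obtains U \<phi> where "(U, \<phi>) \<in> atlas E" "z \<in> U" "fibre_coords E z \<phi>"
  using hermitian_holomorphic_bundle.atlas_cover[OF assms(1)] assms chart_coords[OF assms(1)] by blast

lemma orthonormal_coords_exist:
  assumes E: "hermitian_holomorphic_bundle E" and z: "z \<in> unit_disc"
  obtains \<psi> where "orthonormal_coords E z \<psi>"
proof -
  interpret hermitian_holomorphic_bundle E by (rule E)
  obtain \<phi> where \<phi>: "fibre_coords E z \<phi>" using chart_at[OF E z] by blast
  let ?F = "fibre E z"
  define s where "s = inv_into ?F \<phi>"
  have im: "\<phi> ` ?F = Cn (rk E)" using fibre_coordsD(1)[OF \<phi>] by (simp add: bij_betw_def)
  have s: "s u \<in> ?F" "\<phi> (s u) = u" if "u \<in> Cn (rk E)" for u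
    using that im by (auto simp: s_def inv_into_into f_inv_into_f)
  have s_phi: "s (\<phi> e) = e" if "e \<in> ?F" for e
    using that fibre_coordsD(1)[OF \<phi>] by (simp add: s_def bij_betw_def)
  have s_add: "s (\<lambda>i. u i + v i) = vadd E (s u) (s v)" if "u \<in> Cn (rk E)" "v \<in> Cn (rk E)" for u v
  proof -
    have "\<phi> (vadd E (s u) (s v)) = (\<lambda>i. u i + v i)"
      using fibre_coordsD(2)[OF \<phi> s(1)[OF that(1)] s(1)[OF that(2)]] s(2) that by simp
    then show ?thesis using s_phi[OF vadd_closed] s(1) that by metis
  qed
  have s_scale: "s (\<lambda>i. c * u i) = vscale E c (s u)" if "u \<in> Cn (rk E)" for u c
  proof -
    have "\<phi> (vscale E c (s u)) = (\<lambda>i. c * u i)"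
      using fibre_coordsD(3)[OF \<phi> s(1)[OF that]] s(2) that by simp
    then show ?thesis using s_phi[OF vscale_closed] s(1) that by metis
  qed
  obtain B where B: "bij_betw B (Cn (rk E)) (Cn (rk E))"
    "\<And>u v. \<lbrakk>u \<in> Cn (rk E); v \<in> Cn (rk E)\<rbrakk> \<Longrightarrow> B (\<lambda>i. u i + v i) = (\<lambda>i. B u i + B v i)"
    "\<And>u c. u \<in> Cn (rk E) \<Longrightarrow> B (\<lambda>i. c * u i) = (\<lambda>i. c * B u i)"
    "\<And>u v. \<lbrakk>u \<in> Cn (rk E); v \<in> Cn (rk E)\<rbrakk> \<Longrightarrow> herm E (s u) (s v) = (\<Sum>i<rk E. B u i * cnj (B v i))"
  proof (rule gram_schmidt_Cn[of "rk E" "\<lambda>u v. herm E (s u) (s v)"])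
    have pos: "0 < Re (herm E (s u) (s u))" if u: "u \<in> Cn (rk E)" "u \<noteq> (\<lambda>i. 0)" for u
    proof -
      have "s u \<noteq> vscale E 0 (s u)"
      proof
        assume "s u = vscale E 0 (s u)"
        then have "\<phi> (s u) = (\<lambda>i. 0 * \<phi> (s u) i)"
          using fibre_coordsD(3)[OF \<phi> s(1)[OF u(1)], of 0] by simp
        then show False using s(2)[OF u(1)] u(2) by auto
      qed
      then show ?thesis
        using herm_pos s(1)[OF u(1)] by (simp add: fibre_def)
    qed
    have sym: "herm E (s v) (s u) = cnj (herm E (s u) (s v))"
      if "u \<in> Cn (rk E)" "v \<in> Cn (rk E)" for u v
      using herm_sym s(1) that by blast
    show "positive_hermitian_form (rk E) (\<lambda>u v. herm E (s u) (s v))"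
      unfolding positive_hermitian_form_def
      by (intro conjI ballI allI impI)
        (simp_all only: s_add s_scale s(1) herm_add[of _ z] herm_scale[of _ z],
          rule sym, assumption, assumption, rule pos)
  qed (rule that)
  have \<phi>_in: "\<phi> e \<in> Cn (rk E)" if "e \<in> ?F" for e using fibre_coords_Cn[OF \<phi> that] .
  have "bij_betw (\<lambda>e. B (\<phi> e)) ?F (Cn (rk E))"
    using bij_betw_trans[OF fibre_coordsD(1)[OF \<phi>] B(1)] by (simp add: o_def)
  moreover have "B (\<phi> (vadd E e f)) = (\<lambda>i. B (\<phi> e) i + B (\<phi> f) i)" if "e \<in> ?F" "f \<in> ?F" for e f
    using fibre_coordsD(2)[OF \<phi> that] B(2)[OF \<phi>_in[OF that(1)] \<phi>_in[OF that(2)]] by simp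
  moreover have "B (\<phi> (vscale E c e)) = (\<lambda>i. c * B (\<phi> e) i)" if "e \<in> ?F" for c e
    using fibre_coordsD(3)[OF \<phi> that] B(3)[OF \<phi>_in[OF that]] by simp
  moreover have "herm E e f = (\<Sum>i<rk E. B (\<phi> e) i * cnj (B (\<phi> f) i))" if "e \<in> ?F" "f \<in> ?F" for e f
    using B(4)[OF \<phi>_in[OF that(1)] \<phi>_in[OF that(2)]] s_phi that by simp
  ultimately have "orthonormal_coords E z (\<lambda>e. B (\<phi> e))"
    unfolding orthonormal_coords_def fibre_coords_def by blast
  then show ?thesis by (rule that)
qed


section \<open>Holomorphic bundle maps\<close>

lemma holomorphic_bundle_mapD:
  assumes "holomorphic_bundle_map E F f h"
  shows "f holomorphic_on unit_disc" "\<And>z. z \<in> unit_disc \<Longrightarrow> f z \<in> unit_disc"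
    and "\<And>z. z \<in> unit_disc \<Longrightarrow> fibre_linear E F z (f z) h"
    and "\<And>U \<phi> V \<psi> i j. \<lbrakk>(U, \<phi>) \<in> atlas E; (V, \<psi>) \<in> atlas F; i < rk F; j < rk E\<rbrakk>
      \<Longrightarrow> (\<lambda>z. \<psi> (h (frame E \<phi> j z)) i) holomorphic_on {z \<in> U. f z \<in> V}"
  using assms unfolding holomorphic_bundle_map_def fibre_linear_def by blast+

lemma holomorphic_bundle_mapI:
  assumes "f holomorphic_on unit_disc" "\<And>z. z \<in> unit_disc \<Longrightarrow> f z \<in> unit_disc"
    and "\<And>z. z \<in> unit_disc \<Longrightarrow> fibre_linear E F z (f z) h"
    and "\<And>U \<phi> V \<psi> i j. \<lbrakk>(U, \<phi>) \<in> atlas E; (V, \<psi>) \<in> atlas F; i < rk F; j < rk E\<rbrakk>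
      \<Longrightarrow> (\<lambda>z. \<psi> (h (frame E \<phi> j z)) i) holomorphic_on {z \<in> U. f z \<in> V}"
  shows "holomorphic_bundle_map E F f h"
  using assms unfolding holomorphic_bundle_map_def fibre_linear_def by blast

lemma chart_subset_disc:
  "\<lbrakk>hermitian_holomorphic_bundle E; (U, \<phi>) \<in> atlas E\<rbrakk> \<Longrightarrow> U \<subseteq> unit_disc"
  using hermitian_holomorphic_bundle.atlas_cover by blast

lemma fibre_in_disc:
  "\<lbrakk>hermitian_holomorphic_bundle E; e \<in> fibre E z\<rbrakk> \<Longrightarrow> z \<in> unit_disc"
  using hermitian_holomorphic_bundle.proj_in by (fastforce simp: fibre_def)

lemma Total_in_fibre: "e \<in> Total E \<Longrightarrow> e \<in> fibre E (proj E e)"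
  by (simp add: fibre_def)

lemma open_disc_preimage:
  assumes "f holomorphic_on unit_disc" "open U" "U \<subseteq> unit_disc" "open V"
  shows "open {z \<in> U. f z \<in> V}"
proof -
  have "continuous_on U f"
    using assms holomorphic_on_imp_continuous_on continuous_on_subset by blast
  from continuous_open_preimage[OF this assms(2,4)]
  have "open (U \<inter> f -` V)" .
  moreover have "{z \<in> U. f z \<in> V} = U \<inter> f -` V" by auto
  ultimately show ?thesis by metis
qed

lemma holomorphic_on_locally:
  assumes "\<And>z. z \<in> S \<Longrightarrow> \<exists>T. open T \<and> z \<in> T \<and> q holomorphic_on T"
  shows "q holomorphic_on S"
  unfolding holomorphic_on_def
  using assms holomorphic_on_imp_differentiable_at field_differentiable_at_within by blast

lemma holomorphic_bundle_map_cong: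
  assumes E: "hermitian_holomorphic_bundle E" and h: "holomorphic_bundle_map E F f h"
    and f: "\<And>z. z \<in> unit_disc \<Longrightarrow> g z = f z" and k: "\<And>e. e \<in> Total E \<Longrightarrow> k e = h e"
  shows "holomorphic_bundle_map E F g k"
proof (rule holomorphic_bundle_mapI)
  interpret hermitian_holomorphic_bundle E by (rule E)
  have keq: "k e = h e" if "e \<in> fibre E z" for e z using k that by (simp add: fibre_def)
  show "g holomorphic_on unit_disc"
    by (rule holomorphic_transform[OF holomorphic_bundle_mapD(1)[OF h]]) (simp add: f)
  show "g z \<in> unit_disc" if "z \<in> unit_disc" for z
    using holomorphic_bundle_mapD(2)[OF h] f that by simp
  show "fibre_linear E F z (g z) k" if z: "z \<in> unit_disc" for z
    using holomorphic_bundle_mapD(3)[OF h z] f[OF z]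
    by (auto simp: fibre_linear_def keq[of _ z] vadd_closed[of _ z] vscale_closed[of _ z])
  show "(\<lambda>z. \<psi> (k (frame E \<phi> j z)) i) holomorphic_on {z \<in> U. g z \<in> V}"
    if "(U, \<phi>) \<in> atlas E" "(V, \<psi>) \<in> atlas F" "i < rk F" "j < rk E" for U \<phi> V \<psi> i j
  proof -
    have "{z \<in> U. g z \<in> V} = {z \<in> U. f z \<in> V}"
      using f chart_subset_disc[OF E that(1)] by auto
    moreover have "\<psi> (k (frame E \<phi> j z)) i = \<psi> (h (frame E \<phi> j z)) i" if "z \<in> U" for z
      using keq frame_coords(1)[OF chart_coords[OF E \<open>(U, \<phi>) \<in> atlas E\<close> that] \<open>j < rk E\<close>] by metis
    ultimately show ?thesis
      using holomorphic_transform[OF holomorphic_bundle_mapD(4)[OF h that]] by simp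
  qed
qed

text \<open>
  Near a given point, the matrix of the composite is the product of the matrices with respect to a
  trivialisation of the middle bundle.
\<close>

lemma holomorphic_bundle_map_compose:
  assumes E: "hermitian_holomorphic_bundle E" and F: "hermitian_holomorphic_bundle F"
    and G: "hermitian_holomorphic_bundle G"
    and h: "holomorphic_bundle_map E F f h" and k: "holomorphic_bundle_map F G g k"
  shows "holomorphic_bundle_map E G (\<lambda>z. g (f z)) (\<lambda>e. k (h e))"
proof (rule holomorphic_bundle_mapI)
  note hD = holomorphic_bundle_mapD[OF h] and kD = holomorphic_bundle_mapD[OF k]
  show gf: "(\<lambda>z. g (f z)) holomorphic_on unit_disc"
    using holomorphic_on_compose_gen[OF hD(1) kD(1) image_subsetI[OF hD(2)]] by (simp add: o_def)
  show "g (f z) \<in> unit_disc" if "z \<in> unit_disc" for z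
    using hD(2) kD(2) that by blast
  show "fibre_linear E G z (g (f z)) (\<lambda>e. k (h e))" if "z \<in> unit_disc" for z
    using fibre_linear_compose hD(2,3) kD(3) that by blast
  fix U \<phi> V \<psi> i j
  assume \<phi>: "(U, \<phi>) \<in> atlas E" and \<psi>: "(V, \<psi>) \<in> atlas G" and i: "i < rk G" and j: "j < rk E"
  have U: "open U" "U \<subseteq> unit_disc" and V: "open V"
    using \<phi> \<psi> hermitian_holomorphic_bundle.atlas_open E G chart_subset_disc by blast+
  show "(\<lambda>z. \<psi> (k (h (frame E \<phi> j z))) i) holomorphic_on {z \<in> U. g (f z) \<in> V}"
  proof (rule holomorphic_on_locally)
    fix z0 assume z0: "z0 \<in> {z \<in> U. g (f z) \<in> V}"
    then have "f z0 \<in> unit_disc" using U hD(2) by blast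
    then obtain W \<theta> where \<theta>: "(W, \<theta>) \<in> atlas F" "f z0 \<in> W" using chart_at[OF F] by metis
    have W: "open W" using \<theta> hermitian_holomorphic_bundle.atlas_open F by blast
    define T where "T = {z \<in> U. f z \<in> W} \<inter> {z \<in> U. g (f z) \<in> V}"
    have "open T"
      unfolding T_def using open_disc_preimage[OF hD(1) U W] open_disc_preimage[OF gf U V] by blast
    moreover have "z0 \<in> T" using z0 \<theta> by (simp add: T_def)
    moreover have "(\<lambda>z. \<psi> (k (h (frame E \<phi> j z))) i) holomorphic_on T"
    proof -
      have T_disc: "T \<subseteq> unit_disc" using U by (auto simp: T_def)
      have "(\<lambda>z. \<theta> (h (frame E \<phi> j z)) l * \<psi> (k (frame F \<theta> l (f z))) i) holomorphic_on T"
        if l: "l < rk F" for l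
      proof (rule holomorphic_on_mult)
        show "(\<lambda>z. \<theta> (h (frame E \<phi> j z)) l) holomorphic_on T"
          by (rule holomorphic_on_subset[OF hD(4)[OF \<phi> \<theta>(1) l j]]) (auto simp: T_def)
        have "(\<lambda>w. \<psi> (k (frame F \<theta> l w)) i) \<circ> f holomorphic_on T"
          by (rule holomorphic_on_compose_gen[OF holomorphic_on_subset[OF hD(1) T_disc]
                kD(4)[OF \<theta>(1) \<psi> i l]]) (auto simp: T_def)
        then show "(\<lambda>z. \<psi> (k (frame F \<theta> l (f z))) i) holomorphic_on T" by (simp add: o_def)
      qed
      then have sum_hol: "(\<lambda>z. \<Sum>l<rk F. \<theta> (h (frame E \<phi> j z)) l * \<psi> (k (frame F \<theta> l (f z))) i)
          holomorphic_on T"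
        by (intro holomorphic_on_sum) auto
      have sum_eq: "\<psi> (k (h (frame E \<phi> j z))) i
          = (\<Sum>l<rk F. \<theta> (h (frame E \<phi> j z)) l * \<psi> (k (frame F \<theta> l (f z))) i)"
        if "z \<in> T" for z
      proof (rule coords_linear_expansion[OF F])
        have z: "z \<in> U" "f z \<in> W" "g (f z) \<in> V" "z \<in> unit_disc" using that T_disc by (auto simp: T_def)
        show "fibre_coords F (f z) \<theta>" "fibre_coords G (g (f z)) \<psi>"
          using chart_coords F G \<theta>(1) \<psi> z by blast+
        show "fibre_linear F G (f z) (g (f z)) k" using kD(3) hD(2) z(4) by blast
        show "h (frame E \<phi> j z) \<in> fibre F (f z)"
          using fibre_linearD(1)[OF hD(3)[OF z(4)]] frame_coords(1)[OF chart_coords[OF E \<phi> z(1)] j] .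
      qed
      show ?thesis by (rule holomorphic_transform[OF sum_hol]) (rule sum_eq[symmetric])
    qed
    ultimately show "\<exists>T. open T \<and> z0 \<in> T \<and> (\<lambda>z. \<psi> (k (h (frame E \<phi> j z))) i) holomorphic_on T"
      by blast
  qed
qed

lemma openin_bundle_topology_chart:
  assumes "(U, \<phi>) \<in> atlas E" "open W"
  shows "openin (bundle_topology E) {e \<in> Total E. proj E e \<in> U \<and> (proj E e, \<phi> e) \<in> W}"
  unfolding bundle_topology_def by (rule topology_generated_by_Basis) (use assms in blast)

lemma topspace_bundle_topology:
  assumes "hermitian_holomorphic_bundle E"
  shows "topspace (bundle_topology E) = Total E"
proof -
  have "\<exists>X\<in>{{e \<in> Total E. proj E e \<in> U \<and> (proj E e, \<phi> e) \<in> W} | U \<phi> W.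
      (U, \<phi>) \<in> atlas E \<and> open W}. e \<in> X" if e: "e \<in> Total E" for e
  proof -
    obtain U \<phi> where \<phi>: "(U, \<phi>) \<in> atlas E" "proj E e \<in> U"
      using chart_at[OF assms fibre_in_disc[OF assms Total_in_fibre[OF e]]] by metis
    let ?X = "{e \<in> Total E. proj E e \<in> U \<and> (proj E e, \<phi> e) \<in> UNIV}"
    have "?X \<in> {{e \<in> Total E. proj E e \<in> U \<and> (proj E e, \<phi> e) \<in> W} | U \<phi> W.
      (U, \<phi>) \<in> atlas E \<and> open W}" using \<phi>(1) open_UNIV by blast
    moreover have "e \<in> ?X" using \<phi>(2) e by simp
    ultimately show ?thesis by (rule bexI[rotated])
  qed
  then show ?thesis
    unfolding bundle_topology_def topology_generated_by_topspace by (intro equalityI subsetI) auto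
qed

text \<open>
  In trivialisations the map is \<open>(z, v) \<mapsto> (f z, M z v)\<close> with a matrix \<open>M\<close> that is continuous in \<open>z\<close>.
\<close>

lemma continuous_holomorphic_bundle_map:
  assumes E: "hermitian_holomorphic_bundle E" and F: "hermitian_holomorphic_bundle F"
    and h: "holomorphic_bundle_map E F f h"
  shows "continuous_map (bundle_topology E) (bundle_topology F) h"
proof -
  note hD = holomorphic_bundle_mapD[OF h]
  have h_Total: "h e \<in> Total F \<and> proj F (h e) = f (proj E e)" if "e \<in> Total E" for e
    using fibre_linearD(1)[OF hD(3)[OF fibre_in_disc[OF E]]] Total_in_fibre[OF that]
    by (fastforce simp: fibre_def)
  have open_pre: "openin (bundle_topology E)
      {e \<in> Total E. f (proj E e) \<in> V \<and> (f (proj E e), \<psi> (h e)) \<in> W}"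
    if \<psi>: "(V, \<psi>) \<in> atlas F" and W: "open W" for V \<psi> W
  proof (subst openin_subopen, intro ballI)
    fix e0 assume e0: "e0 \<in> {e \<in> Total E. f (proj E e) \<in> V \<and> (f (proj E e), \<psi> (h e)) \<in> W}"
    let ?z0 = "proj E e0"
    have "?z0 \<in> unit_disc" using e0 fibre_in_disc[OF E Total_in_fibre] by blast
    then obtain U \<phi> where \<phi>: "(U, \<phi>) \<in> atlas E" "?z0 \<in> U" using chart_at[OF E] by metis
    have U: "open U" "U \<subseteq> unit_disc" and V: "open V"
      using \<phi> \<psi> hermitian_holomorphic_bundle.atlas_open E F chart_subset_disc by blast+
    define S where "S = {z \<in> U. f z \<in> V}"
    have S: "open S" "S \<subseteq> unit_disc"
      using open_disc_preimage[OF hD(1) U V] U by (auto simp: S_def)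
    define M where "M x = (f (fst x), \<lambda>i. if i < rk F
        then \<Sum>j<rk E. snd x j * \<psi> (h (frame E \<phi> j (fst x))) i else 0)"
      for x :: "complex \<times> (nat \<Rightarrow> complex)"
    have M_eq: "M (proj E e, \<phi> e) = (f (proj E e), \<psi> (h e))" if e: "e \<in> Total E" "proj E e \<in> S" for e
    proof -
      let ?z = "proj E e"
      have z: "?z \<in> U" "f ?z \<in> V" "?z \<in> unit_disc" using e(2) S by (auto simp: S_def)
      have lin: "fibre_linear E F ?z (f ?z) h" using hD(3) z(3) .
      have \<psi>': "fibre_coords F (f ?z) \<psi>" using chart_coords[OF F \<psi> z(2)] .
      have e': "e \<in> fibre E ?z" by (rule Total_in_fibre[OF e(1)])
      have "\<psi> (h e) i = (\<Sum>j<rk E. \<phi> e j * \<psi> (h (frame E \<phi> j ?z)) i)" for i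
        by (rule coords_linear_expansion[OF E chart_coords[OF E \<phi>(1) z(1)] \<psi>' lin e'])
      moreover have "\<psi> (h e) i = 0" if "\<not> i < rk F" for i
        using fibre_coords_zero_beyond[OF \<psi>' fibre_linearD(1)[OF lin e']] that by simp
      ultimately show ?thesis by (auto simp: M_def fun_eq_iff)
    qed
    have "continuous_on (S \<times> UNIV) M"
      unfolding M_def
    proof (intro continuous_on_Pair continuous_on_coordinatewise_then_product)
      have fst_S: "continuous_on (S \<times> UNIV) (\<lambda>x. q (fst x))"
        if "q holomorphic_on S" for q :: "complex \<Rightarrow> complex"
        by (rule continuous_on_compose2[OF holomorphic_on_imp_continuous_on[OF that]])
          (auto intro: continuous_intros)
      show "continuous_on (S \<times> UNIV) (\<lambda>x :: complex \<times> (nat \<Rightarrow> complex). f (fst x))"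
        using fst_S holomorphic_on_subset[OF hD(1) S(2)] by blast
      fix i
      have "continuous_on (S \<times> UNIV) (\<lambda>x. snd x j * \<psi> (h (frame E \<phi> j (fst x))) i)"
        if "i < rk F" "j < rk E" for j
      proof (intro continuous_on_mult)
        show "continuous_on (S \<times> UNIV) (\<lambda>x :: complex \<times> (nat \<Rightarrow> complex). snd x j)"
          by (rule continuous_on_compose2[OF continuous_on_product_coordinates[of j]])
            (auto intro: continuous_intros)
        show "continuous_on (S \<times> UNIV) (\<lambda>x. \<psi> (h (frame E \<phi> j (fst x))) i)"
          using fst_S hD(4)[OF \<phi>(1) \<psi> that] by (simp add: S_def)
      qed
      then show "continuous_on (S \<times> UNIV) (\<lambda>x. if i < rk F
          then \<Sum>j<rk E. snd x j * \<psi> (h (frame E \<phi> j (fst x))) i else 0)"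
        by (cases "i < rk F") (auto intro!: continuous_on_sum)
    qed
    from continuous_open_preimage[OF this _ W]
    have W': "open ((S \<times> UNIV) \<inter> M -` W)" using S open_Times open_UNIV by blast
    let ?N = "{e \<in> Total E. proj E e \<in> U \<and> (proj E e, \<phi> e) \<in> (S \<times> UNIV) \<inter> M -` W}"
    have "openin (bundle_topology E) ?N"
      by (rule openin_bundle_topology_chart[OF \<phi>(1) W'])
    moreover have "e0 \<in> ?N" using e0 \<phi>(2) M_eq by (auto simp: S_def)
    moreover have "?N \<subseteq> {e \<in> Total E. f (proj E e) \<in> V \<and> (f (proj E e), \<psi> (h e)) \<in> W}"
      using M_eq by (auto simp: S_def)
    ultimately show "\<exists>T. openin (bundle_topology E) T \<and> e0 \<in> T \<and>
        T \<subseteq> {e \<in> Total E. f (proj E e) \<in> V \<and> (f (proj E e), \<psi> (h e)) \<in> W}"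
      by blast
  qed
  show ?thesis
    unfolding bundle_topology_def[of F]
  proof (rule continuous_on_generated_topo)
    fix X
    assume "X \<in> {{e \<in> Total F. proj F e \<in> U \<and> (proj F e, \<phi> e) \<in> W} | U \<phi> W.
        (U, \<phi>) \<in> atlas F \<and> open W}"
    then obtain V \<psi> W where \<psi>: "(V, \<psi>) \<in> atlas F" "open W"
      and X: "X = {e \<in> Total F. proj F e \<in> V \<and> (proj F e, \<psi> e) \<in> W}" by blast
    have "h -` X \<inter> topspace (bundle_topology E)
        = {e \<in> Total E. f (proj E e) \<in> V \<and> (f (proj E e), \<psi> (h e)) \<in> W}"
      unfolding X topspace_bundle_topology[OF E] using h_Total by auto
    then show "openin (bundle_topology E) (h -` X \<inter> topspace (bundle_topology E))"
      using open_pre[OF \<psi>] by simp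
  next
    have "h ` Total E \<subseteq> topspace (bundle_topology F)"
      using h_Total by (auto simp: topspace_bundle_topology[OF F])
    then show "h ` topspace (bundle_topology E) \<subseteq> \<Union> {{e \<in> Total F. proj F e \<in> U \<and> (proj F e, \<phi> e) \<in> W}
        | U \<phi> W. (U, \<phi>) \<in> atlas F \<and> open W}"
      by (simp only: topspace_bundle_topology[OF E] bundle_topology_def[of F] topology_generated_by_topspace)
  qed
qed

lemma openin_chart_coordinate:
  assumes "(U, \<phi>) \<in> atlas E" "open X"
  shows "openin (bundle_topology E) {e \<in> Total E. proj E e \<in> U \<and> \<phi> e i \<in> X}"
proof -
  have "open {x :: complex \<times> (nat \<Rightarrow> complex). snd x i \<in> X}"
  proof -
    have "continuous_on UNIV (\<lambda>x :: complex \<times> (nat \<Rightarrow> complex). snd x i)"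
      by (rule continuous_on_compose2[OF continuous_on_product_coordinates[of i]])
        (auto intro: continuous_intros)
    from open_vimage[OF assms(2) this] show ?thesis by (simp add: vimage_def)
  qed
  from openin_bundle_topology_chart[OF assms(1) this] show ?thesis by simp
qed


section \<open>The projections of an orthogonal direct sum\<close>

text \<open>
  A substitute for the holomorphy of the inverse of a matrix: near \<open>z0\<close> the matrix \<open>N\<close> is a small
  perturbation of the identity, which first bounds the solution, then makes it continuous at \<open>z0\<close>, and
  finally differentiable there.
\<close>

lemma linear_system_solution_differentiable:
  fixes N :: "nat \<Rightarrow> nat \<Rightarrow> complex \<Rightarrow> complex" and q :: "nat \<Rightarrow> complex \<Rightarrow> complex"
  assumes S: "open S" "z0 \<in> S"
    and N_hol: "\<And>j l. \<lbrakk>j < r; l < r\<rbrakk> \<Longrightarrow> N j l holomorphic_on S"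
    and N_z0: "\<And>j l. \<lbrakk>j < r; l < r\<rbrakk> \<Longrightarrow> N j l z0 = (if j = l then 1 else 0)"
    and eq: "\<And>j z. \<lbrakk>j < r; z \<in> S\<rbrakk> \<Longrightarrow> (\<Sum>l<r. N j l z * q l z) = \<gamma> j"
    and j: "j < r"
  shows "q j field_differentiable at z0"
proof -
  define \<delta> where "\<delta> j l z = N j l z - (if j = l then 1 else 0)" for j l z
  have \<delta>0: "\<delta> k l z0 = 0" if "k < r" "l < r" for k l using N_z0 that by (simp add: \<delta>_def)
  have \<delta>_diff: "\<delta> k l field_differentiable at z0" if "k < r" "l < r" for k l
    unfolding \<delta>_def using holomorphic_on_imp_differentiable_at[OF N_hol[OF that] S]
    by (intro derivative_intros) auto
  have \<delta>_lim: "(\<delta> k l \<longlongrightarrow> 0) (at z0)" if "k < r" "l < r" for k l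
    using field_differentiable_imp_continuous_at[OF \<delta>_diff[OF that]] \<delta>0[OF that]
    by (simp add: continuous_at)
  have q_eq: "q k z = \<gamma> k - (\<Sum>l<r. \<delta> k l z * q l z)" if "k < r" "z \<in> S" for k z
  proof -
    have "(\<Sum>l<r. N k l z * q l z) = (\<Sum>l<r. \<delta> k l z * q l z + (if l = k then q k z else 0))"
      by (intro sum.cong) (auto simp: \<delta>_def algebra_simps)
    then show ?thesis using eq[OF that] that by (simp add: sum.distrib)
  qed
  have q_z0: "q k z0 = \<gamma> k" if "k < r" for k using q_eq[OF that S(2)] \<delta>0 that by simp
  have in_S: "eventually (\<lambda>z. z \<in> S) (at z0)"
    using S by (simp add: eventually_at_topological) blast
  \<comment> \<open>the solution stays bounded, since the system is a small perturbation of the identity\<close>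
  define K where "K = 2 * (\<Sum>k<r. norm (\<gamma> k))"
  have "eventually (\<lambda>z. norm (\<delta> k l z) < 1 / (2 * (real r + 1))) (at z0)" if "k < r" "l < r" for k l
    using tendstoD[OF \<delta>_lim[OF that], of "1 / (2 * (real r + 1))"] by simp
  then have "eventually (\<lambda>z. \<forall>k\<in>{..<r}. \<forall>l\<in>{..<r}. norm (\<delta> k l z) < 1 / (2 * (real r + 1))) (at z0)"
    by (simp add: eventually_ball_finite)
  then have bound: "eventually (\<lambda>z. \<forall>l<r. norm (q l z) \<le> K) (at z0)"
    using in_S
  proof eventually_elim
    case (elim z)
    define m where "m = (\<Sum>l<r. norm (q l z))"
    have "norm (q k z) \<le> norm (\<gamma> k) + m / (2 * (real r + 1))" if "k < r" for k
    proof -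
      have "norm (\<Sum>l<r. \<delta> k l z * q l z) \<le> (\<Sum>l<r. 1 / (2 * (real r + 1)) * norm (q l z))"
      proof (rule sum_norm_le)
        fix l assume "l \<in> {..<r}"
        then have "norm (\<delta> k l z) \<le> 1 / (2 * (real r + 1))"
          using elim(1) that by (meson lessThan_iff less_imp_le)
        then show "norm (\<delta> k l z * q l z) \<le> 1 / (2 * (real r + 1)) * norm (q l z)"
          unfolding norm_mult by (intro mult_right_mono) auto
      qed
      also have "\<dots> = m / (2 * (real r + 1))" by (simp add: m_def sum_divide_distrib)
      finally show ?thesis using q_eq[OF that elim(2)] norm_triangle_ineq4[of "\<gamma> k"] by (metis add_left_mono order_trans)
    qed
    then have "m \<le> (\<Sum>k<r. norm (\<gamma> k) + m / (2 * (real r + 1)))"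
      unfolding m_def by (intro sum_mono) auto
    also have "\<dots> = K / 2 + real r * (m / (2 * (real r + 1)))" by (simp add: sum.distrib K_def)
    also have "real r * (m / (2 * (real r + 1))) \<le> m / 2"
    proof -
      have "m \<ge> 0" unfolding m_def by (intro sum_nonneg) auto
      then show ?thesis by (simp add: field_simps)
    qed
    finally have "m \<le> K" by simp
    moreover have "norm (q l z) \<le> m" if "l < r" for l
      unfolding m_def using that by (intro member_le_sum) auto
    ultimately show ?case by (meson order_trans)
  qed
  have q_lim: "(q k \<longlongrightarrow> q k z0) (at z0)" if k: "k < r" for k
  proof -
    have "((\<lambda>z. \<delta> k l z * q l z) \<longlongrightarrow> 0) (at z0)" if l: "l < r" for l
    proof (rule Lim_null_comparison)
      show "eventually (\<lambda>z. norm (\<delta> k l z * q l z) \<le> norm (\<delta> k l z) * K) (at z0)"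
        using bound by eventually_elim (auto simp: norm_mult l intro!: mult_left_mono)
      show "((\<lambda>z. norm (\<delta> k l z) * K) \<longlongrightarrow> 0) (at z0)"
        using tendsto_mult_left_zero[OF tendsto_norm_zero[OF \<delta>_lim[OF k l]]] .
    qed
    then have "((\<lambda>z. \<gamma> k - (\<Sum>l<r. \<delta> k l z * q l z)) \<longlongrightarrow> \<gamma> k - (\<Sum>l<r. 0)) (at z0)"
      by (intro tendsto_diff tendsto_sum tendsto_const) auto
    then show ?thesis
      using q_eq[OF k] in_S q_z0[OF k]
      by (auto elim!: Lim_transform_eventually eventually_mono)
  qed
  have "((\<lambda>z. (q j z - q j z0) / (z - z0)) \<longlongrightarrow> - (\<Sum>l<r. deriv (\<delta> j l) z0 * q l z0)) (at z0)"
  proof (rule Lim_transform_eventually)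
    have "((\<lambda>z. (\<delta> j l z - \<delta> j l z0) / (z - z0)) \<longlongrightarrow> deriv (\<delta> j l) z0) (at z0)" if "l < r" for l
      using \<delta>_diff[OF j that] by (simp add: field_differentiable_derivI flip: has_field_derivative_iff)
    then show "((\<lambda>z. - (\<Sum>l<r. (\<delta> j l z - \<delta> j l z0) / (z - z0) * q l z))
        \<longlongrightarrow> - (\<Sum>l<r. deriv (\<delta> j l) z0 * q l z0)) (at z0)"
      by (intro tendsto_minus tendsto_sum tendsto_mult q_lim) auto
    show "eventually (\<lambda>z. - (\<Sum>l<r. (\<delta> j l z - \<delta> j l z0) / (z - z0) * q l z)
        = (q j z - q j z0) / (z - z0)) (at z0)"
      using in_S
    proof eventually_elim
      case (elim z)
      have "(\<Sum>l<r. (\<delta> j l z - \<delta> j l z0) / (z - z0) * q l z) = (\<Sum>l<r. \<delta> j l z * q l z) / (z - z0)"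
        using \<delta>0[OF j] by (simp add: sum_divide_distrib)
      then show ?case using q_eq[OF j elim] q_z0[OF j] by simp
    qed
  qed
  then show ?thesis
    unfolding field_differentiable_def has_field_derivative_iff by blast
qed

lemma subbundleD:
  assumes "hermitian_holomorphic_subbundle F E"
  shows "hermitian_holomorphic_bundle F" "holomorphic_bundle_map F E (\<lambda>z. z) (\<lambda>e. e)"
    and "Total F \<subseteq> Total E"
    and "\<And>e z. e \<in> fibre F z \<Longrightarrow> e \<in> fibre E z"
    and "\<And>e f z. \<lbrakk>e \<in> fibre F z; f \<in> fibre F z\<rbrakk> \<Longrightarrow> vadd F e f = vadd E e f"
    and "\<And>e c z. e \<in> fibre F z \<Longrightarrow> vscale F c e = vscale E c e"
    and "\<And>e f z. \<lbrakk>e \<in> fibre F z; f \<in> fibre F z\<rbrakk> \<Longrightarrow> herm F e f = herm E e f"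
proof -
  show F: "hermitian_holomorphic_bundle F" and i: "holomorphic_bundle_map F E (\<lambda>z. z) (\<lambda>e. e)"
    and "Total F \<subseteq> Total E"
    using assms by (auto simp: hermitian_holomorphic_subbundle_def)
  note lin = fibre_linearD[OF holomorphic_bundle_mapD(3)[OF i fibre_in_disc[OF F]]]
  show "\<And>e z. e \<in> fibre F z \<Longrightarrow> e \<in> fibre E z"
    and "\<And>e f z. \<lbrakk>e \<in> fibre F z; f \<in> fibre F z\<rbrakk> \<Longrightarrow> vadd F e f = vadd E e f"
    and "\<And>e c z. e \<in> fibre F z \<Longrightarrow> vscale F c e = vscale E c e"
    using lin by blast+
  show "\<And>e f z. \<lbrakk>e \<in> fibre F z; f \<in> fibre F z\<rbrakk> \<Longrightarrow> herm F e f = herm E e f"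
    using assms fibre_in_disc[OF F] unfolding hermitian_holomorphic_subbundle_def by metis
qed

lemma vector_with_coords:
  assumes "fibre_coords E z \<phi>" "x \<in> Cn (rk E)"
  obtains e where "e \<in> fibre E z" "\<phi> e = x"
  using fibre_coordsD(1)[OF assms(1)] assms(2) by (metis bij_betw_iff_bijections)

definition first_component :: "'e vbundle \<Rightarrow> 'e vbundle \<Rightarrow> 'e vbundle \<Rightarrow> 'e \<Rightarrow> 'e" where
  "first_component E E1 E2 e =
     fst (inv_into (fibre E1 (proj E e) \<times> fibre E2 (proj E e)) (\<lambda>(e1, e2). vadd E e1 e2) e)"

locale orthogonal_splitting = hermitian_holomorphic_bundle E for E :: "'e vbundle" +
  fixes E1 E2 :: "'e vbundle"
  assumes splitting: "orthogonal_direct_sum E E1 E2"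
begin

abbreviation "P \<equiv> first_component E E1 E2"

lemma bundle_E: "hermitian_holomorphic_bundle E" by unfold_locales

lemma sub: "hermitian_holomorphic_subbundle E1 E" "hermitian_holomorphic_subbundle E2 E"
  using splitting by (auto simp: orthogonal_direct_sum_def)

lemmas sub1 = subbundleD[OF sub(1)] and sub2 = subbundleD[OF sub(2)]

lemma sum_bij:
  "z \<in> unit_disc \<Longrightarrow> bij_betw (\<lambda>(e1, e2). vadd E e1 e2) (fibre E1 z \<times> fibre E2 z) (fibre E z)"
  using splitting by (auto simp: orthogonal_direct_sum_def)

lemma orthogonal: "\<lbrakk>e1 \<in> fibre E1 z; e2 \<in> fibre E2 z\<rbrakk> \<Longrightarrow> herm E e1 e2 = 0"
  using splitting fibre_in_disc[OF sub1(1)] unfolding orthogonal_direct_sum_def by blast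

lemma P_vadd:
  assumes "e1 \<in> fibre E1 z" "e2 \<in> fibre E2 z"
  shows "P (vadd E e1 e2) = e1"
proof -
  have z: "z \<in> unit_disc" using fibre_in_disc[OF sub1(1) assms(1)] .
  have "vadd E e1 e2 \<in> fibre E z" using vadd_closed sub1(4) sub2(4) assms by blast
  then have "proj E (vadd E e1 e2) = z" by (simp add: fibre_def)
  then show ?thesis
    using inv_into_f_f[OF bij_betw_imp_inj_on[OF sum_bij[OF z]], of "(e1, e2)"] assms
    by (simp add: first_component_def)
qed

lemma decompose:
  assumes "e \<in> fibre E z"
  obtains e1 e2 where "e1 \<in> fibre E1 z" "e2 \<in> fibre E2 z" "e = vadd E e1 e2" "P e = e1"
proof -
  have "e \<in> (\<lambda>(e1, e2). vadd E e1 e2) ` (fibre E1 z \<times> fibre E2 z)"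
    using sum_bij[OF fibre_in_disc[OF bundle_E assms]] assms by (simp add: bij_betw_def)
  then show ?thesis using that P_vadd by auto
qed

lemma P_in: "e \<in> fibre E z \<Longrightarrow> P e \<in> fibre E1 z"
  by (metis decompose)

lemma P_linear:
  assumes z: "z \<in> unit_disc"
  shows "fibre_linear E E1 z z P"
  unfolding fibre_linear_def
proof (intro conjI ballI allI)
  obtain \<phi> where \<phi>: "fibre_coords E z \<phi>" using chart_at[OF bundle_E z] by blast
  note \<phi>D = fibre_coordsD[OF \<phi>]
  interpret E1: hermitian_holomorphic_bundle E1 by (rule sub1(1))
  interpret E2: hermitian_holomorphic_bundle E2 by (rule sub2(1))
  show "P e \<in> fibre E1 z" if "e \<in> fibre E z" for e using P_in that .
  show "P (vadd E e f) = vadd E1 (P e) (P f)" if e: "e \<in> fibre E z" and f: "f \<in> fibre E z" for e f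
  proof -
    obtain e1 e2 where e12: "e1 \<in> fibre E1 z" "e2 \<in> fibre E2 z" "e = vadd E e1 e2" "P e = e1"
      using decompose[OF e] .
    obtain f1 f2 where f12: "f1 \<in> fibre E1 z" "f2 \<in> fibre E2 z" "f = vadd E f1 f2" "P f = f1"
      using decompose[OF f] .
    note in_E = sub1(4)[OF e12(1)] sub2(4)[OF e12(2)] sub1(4)[OF f12(1)] sub2(4)[OF f12(2)]
    have "\<phi> (vadd E e f) = \<phi> (vadd E (vadd E e1 f1) (vadd E e2 f2))"
      unfolding e12(3) f12(3) using in_E by (simp add: \<phi>D(2) vadd_closed add_ac)
    then have "vadd E e f = vadd E (vadd E1 e1 f1) (vadd E2 e2 f2)"
      using fibre_coords_inj[OF \<phi>] vadd_closed e f in_E sub1(5)[OF e12(1) f12(1)]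
        sub2(5)[OF e12(2) f12(2)] by metis
    then show ?thesis
      using P_vadd[OF E1.vadd_closed[OF e12(1) f12(1)] E2.vadd_closed[OF e12(2) f12(2)]] e12 f12
      by simp
  qed
  show "P (vscale E c e) = vscale E1 c (P e)" if e: "e \<in> fibre E z" for e c
  proof -
    obtain e1 e2 where e12: "e1 \<in> fibre E1 z" "e2 \<in> fibre E2 z" "e = vadd E e1 e2" "P e = e1"
      using decompose[OF e] .
    note in_E = sub1(4)[OF e12(1)] sub2(4)[OF e12(2)]
    have "\<phi> (vscale E c e) = \<phi> (vadd E (vscale E c e1) (vscale E c e2))"
      unfolding e12(3) using in_E by (simp add: \<phi>D(2,3) vadd_closed vscale_closed algebra_simps)
    then have "vscale E c e = vadd E (vscale E1 c e1) (vscale E2 c e2)"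
      using fibre_coords_inj[OF \<phi>] vadd_closed vscale_closed e in_E sub1(6)[OF e12(1)]
        sub2(6)[OF e12(2)] by metis
    then show ?thesis
      using P_vadd[OF E1.vscale_closed[OF e12(1)] E2.vscale_closed[OF e12(2)]] e12 by simp
  qed
qed

lemma P_E1:
  assumes "e \<in> fibre E1 z"
  shows "P e = e"
proof -
  have z: "z \<in> unit_disc" using fibre_in_disc[OF sub1(1) assms] .
  obtain \<phi> where \<phi>: "fibre_coords E z \<phi>" using chart_at[OF bundle_E z] by blast
  obtain \<psi> where \<psi>: "fibre_coords E2 z \<psi>" using chart_at[OF sub2(1) z] by blast
  obtain n where n: "n \<in> fibre E2 z" "\<psi> n = (\<lambda>i. 0)"
    using vector_with_coords[OF \<psi>, of "\<lambda>i. 0"] by (auto simp: Cn_def)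
  \<comment> \<open>\<open>n\<close> is the zero vector of \<open>E2\<close>; it is also that of \<open>E\<close>, being \<open>0\<close> times itself\<close>
  have "vscale E2 0 n = n"
    by (rule fibre_coords_inj[OF \<psi>])
      (use n fibre_coordsD(3)[OF \<psi>] hermitian_holomorphic_bundle.vscale_closed[OF sub2(1)] in auto)
  then have "\<phi> n = (\<lambda>i. 0)"
    using sub2(6)[OF n(1), of 0] fibre_coordsD(3)[OF \<phi> sub2(4)[OF n(1)], of 0] by simp
  then have "vadd E e n = e"
    using fibre_coords_inj[OF \<phi>] fibre_coordsD(2)[OF \<phi> sub1(4)[OF assms] sub2(4)[OF n(1)]]
      vadd_closed[OF sub1(4)[OF assms] sub2(4)[OF n(1)]] sub1(4)[OF assms] by auto
  then show ?thesis using P_vadd[OF assms n(1)] by simp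
qed

lemma P_self_adjoint:
  assumes e: "e \<in> fibre E z" and f: "f \<in> fibre E z"
  shows "herm E (P e) f = herm E e (P f)"
proof -
  obtain e1 e2 where e12: "e1 \<in> fibre E1 z" "e2 \<in> fibre E2 z" "e = vadd E e1 e2" "P e = e1"
    using decompose[OF e] .
  obtain f1 f2 where f12: "f1 \<in> fibre E1 z" "f2 \<in> fibre E2 z" "f = vadd E f1 f2" "P f = f1"
    using decompose[OF f] .
  note in_E = sub1(4)[OF e12(1)] sub2(4)[OF e12(2)] sub1(4)[OF f12(1)] sub2(4)[OF f12(2)]
  have "herm E e1 f = cnj (herm E f1 e1 + herm E f2 e1)"
    using herm_sym[OF f in_E(1)] herm_add[OF in_E(3,4,1)] f12(3) by simp
  also have "\<dots> = herm E e1 f1"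
    using herm_sym[OF in_E(3,1)] herm_sym[OF in_E(1,4)] orthogonal[OF e12(1) f12(2)] by simp
  also have "\<dots> = herm E e f1"
    using herm_add[OF in_E(1,2,3)] e12(3) herm_sym[OF in_E(3,2)] orthogonal[OF f12(1) e12(2)] by simp
  finally show ?thesis using e12(4) f12(4) by simp
qed

text \<open>
  Fix \<open>z0\<close> and move the decomposition of the frame vectors of \<open>E\<close> at \<open>z0\<close> to nearby \<open>z\<close> by keeping the
  coordinates \<open>x1\<close>, \<open>x2\<close> of both components constant. The resulting vectors have holomorphic coordinates
  \<open>N\<close> with respect to the frame of \<open>E\<close>, and their projections have the constant coordinates \<open>x1\<close>. So
  the entries of the matrix of \<open>P\<close> solve a holomorphic linear system whose matrix is the identity at \<open>z0\<close>.
\<close>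

lemma P_holomorphic: "holomorphic_bundle_map E E1 (\<lambda>z. z) P"
proof (rule holomorphic_bundle_mapI)
  fix U \<phi> V \<psi> i j
  assume \<phi>: "(U, \<phi>) \<in> atlas E" and \<psi>: "(V, \<psi>) \<in> atlas E1" and i: "i < rk E1" and j: "j < rk E"
  have UV: "open U" "open V" "U \<subseteq> unit_disc"
    using \<phi> \<psi> atlas_open hermitian_holomorphic_bundle.atlas_open[OF sub1(1)]
      chart_subset_disc[OF bundle_E] by blast+
  define q where "q l z = \<psi> (P (frame E \<phi> l z)) i" for l z
  have "q j field_differentiable at z0" if z0: "z0 \<in> U \<inter> V" for z0
  proof -
    obtain V2 \<psi>2 where \<psi>2: "(V2, \<psi>2) \<in> atlas E2" "z0 \<in> V2" using chart_at[OF sub2(1)] z0 UV by blast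
    define S where "S = U \<inter> V \<inter> V2"
    have S: "open S" "z0 \<in> S"
      using UV hermitian_holomorphic_bundle.atlas_open[OF sub2(1) \<psi>2(1)] z0 \<psi>2(2)
      by (auto simp: S_def)
    have c: "fibre_coords E z \<phi>" "fibre_coords E1 z \<psi>" "fibre_coords E2 z \<psi>2" "z \<in> unit_disc"
      if "z \<in> S" for z
      using that chart_coords[OF bundle_E \<phi>] chart_coords[OF sub1(1) \<psi>] chart_coords[OF sub2(1) \<psi>2(1)]
        UV by (auto simp: S_def)
    note c0 = c[OF S(2)]
    \<comment> \<open>the coordinates of the two components of the frame vectors at \<open>z0\<close>\<close>
    have "\<exists>e1 e2. e1 \<in> fibre E1 z0 \<and> e2 \<in> fibre E2 z0 \<and> frame E \<phi> l z0 = vadd E e1 e2"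
      if "l < rk E" for l
      using decompose[OF frame_coords(1)[OF c0(1) that]] by metis
    then obtain e1 e2 where e12: "\<And>l. l < rk E \<Longrightarrow> e1 l \<in> fibre E1 z0 \<and> e2 l \<in> fibre E2 z0 \<and>
        frame E \<phi> l z0 = vadd E (e1 l) (e2 l)"
      by metis
    define x1 x2 where "x1 l = \<psi> (e1 l)" and "x2 l = \<psi>2 (e2 l)" for l
    define N where "N k l z = (\<Sum>m<rk E1. x1 k m * \<phi> (frame E1 \<psi> m z) l)
        + (\<Sum>m<rk E2. x2 k m * \<phi> (frame E2 \<psi>2 m z) l)" for k l z
    have N: "\<phi> (vadd E c1 c2) l = N k l z"
      if z: "z \<in> S" and c12: "c1 \<in> fibre E1 z" "c2 \<in> fibre E2 z" "\<psi> c1 = x1 k" "\<psi>2 c2 = x2 k"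
      for k l z c1 c2
      using fibre_coordsD(2)[OF c(1)[OF z] sub1(4)[OF c12(1)] sub2(4)[OF c12(2)]]
        coords_linear_expansion[OF sub1(1) c(2)[OF z] c(1)[OF z]
          holomorphic_bundle_mapD(3)[OF sub1(2) c(4)[OF z]] c12(1), of l]
        coords_linear_expansion[OF sub2(1) c(3)[OF z] c(1)[OF z]
          holomorphic_bundle_mapD(3)[OF sub2(2) c(4)[OF z]] c12(2), of l] c12(3,4)
      by (simp add: N_def)
    show ?thesis
    proof (rule linear_system_solution_differentiable[OF S, of "rk E" N _ "\<lambda>k. x1 k i"])
      fix k l assume kl: "k < rk E" "l < rk E"
      have "(\<lambda>z. \<phi> (frame E1 \<psi> m z) l) holomorphic_on S" if "m < rk E1" for m
        by (rule holomorphic_on_subset[OF holomorphic_bundle_mapD(4)[OF sub1(2) \<psi> \<phi> kl(2) that]])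
          (auto simp: S_def)
      moreover have "(\<lambda>z. \<phi> (frame E2 \<psi>2 m z) l) holomorphic_on S" if "m < rk E2" for m
        by (rule holomorphic_on_subset[OF holomorphic_bundle_mapD(4)[OF sub2(2) \<psi>2(1) \<phi> kl(2) that]])
          (auto simp: S_def)
      ultimately show "N k l holomorphic_on S"
        unfolding N_def by (intro holomorphic_on_add holomorphic_on_sum holomorphic_on_mult
            holomorphic_on_const) auto
      have "N k l z0 = \<phi> (frame E \<phi> k z0) l"
        using N[OF S(2), of "e1 k" "e2 k" k l] e12[OF kl(1)] by (simp add: x1_def x2_def)
      then show "N k l z0 = (if k = l then 1 else 0)"
        using frame_coords(2)[OF c0(1) kl(1)] by (simp add: unit_vec_def)
    next
      fix k z assume k: "k < rk E" and z: "z \<in> S"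
      have "x1 k \<in> Cn (rk E1)" "x2 k \<in> Cn (rk E2)"
        using fibre_coords_Cn[OF c0(2)] fibre_coords_Cn[OF c0(3)] e12[OF k] by (auto simp: x1_def x2_def)
      then obtain c1 c2 where c12: "c1 \<in> fibre E1 z" "\<psi> c1 = x1 k" "c2 \<in> fibre E2 z" "\<psi>2 c2 = x2 k"
        using vector_with_coords c(2,3)[OF z] by metis
      have "vadd E c1 c2 \<in> fibre E z" using vadd_closed sub1(4) sub2(4) c12 by blast
      from coords_linear_expansion[OF bundle_E c(1)[OF z] c(2)[OF z] P_linear[OF c(4)[OF z]] this, of i]
      have "x1 k i = (\<Sum>l<rk E. \<phi> (vadd E c1 c2) l * q l z)"
        using P_vadd[OF c12(1,3)] c12(2) by (simp add: q_def)
      then show "(\<Sum>l<rk E. N k l z * q l z) = x1 k i"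
        using N[OF z c12(1,3,2,4)] by simp
    qed (rule j)
  qed
  moreover have "{z \<in> U. z \<in> V} = U \<inter> V" by auto
  ultimately show "(\<lambda>z. \<psi> (P (frame E \<phi> j z)) i) holomorphic_on {z \<in> U. z \<in> V}"
    unfolding holomorphic_on_def q_def[symmetric] using field_differentiable_at_within by metis
qed (use P_linear in auto)

end


section \<open>Contracted elements generate the covering group\<close>

text \<open>
  The isomorphism of \<open>SL(2,\<real>)\<close> with \<open>SU(1,1)\<close>: the element with first row \<open>a\<close>, \<open>b\<close> acts on
  \<open>\<complex> = \<real>\<^sup>2\<close> by \<open>w \<mapsto> a w + b (cnj w)\<close>, and \<open>k\<close>, \<open>l\<close>, \<open>m\<close>, \<open>n\<close> are the entries of the matrix
  of this map in the basis \<open>1\<close>, \<open>\<i>\<close>, row by row.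
\<close>

definition real_form :: "real \<Rightarrow> real \<Rightarrow> real \<Rightarrow> real \<Rightarrow> complex^2^2" where
  "real_form k l m n =
     (let a = Complex ((k + n) / 2) ((m - l) / 2); b = Complex ((k - n) / 2) ((m + l) / 2)
      in vector [vector [a, b], vector [cnj b, cnj a]])"

lemma real_form_nth:
  "real_form k l m n $ 1 $ 1 = Complex ((k + n) / 2) ((m - l) / 2)"
  "real_form k l m n $ 1 $ 2 = Complex ((k - n) / 2) ((m + l) / 2)"
  "real_form k l m n $ 2 $ 1 = Complex ((k - n) / 2) (- ((m + l) / 2))"
  "real_form k l m n $ 2 $ 2 = Complex ((k + n) / 2) (- ((m - l) / 2))"
  by (simp_all add: real_form_def Let_def complex_eq_iff)

lemma real_form_mult:
  "real_form k l m n ** real_form k' l' m' n'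
    = real_form (k * k' + l * m') (k * l' + l * n') (m * k' + n * m') (m * l' + n * n')"
  by (simp add: vec_eq_iff forall_2 matrix_matrix_mult_def sum_2 real_form_nth complex_eq_iff)
    (simp add: field_simps)

lemma real_form_one: "real_form 1 0 0 1 = mat 1"
  by (simp add: vec_eq_iff forall_2 mat_def real_form_nth complex_eq_iff)

lemma real_form_in_SU11: "k * n - l * m = 1 \<Longrightarrow> real_form k l m n \<in> SU11"
  by (simp add: SU11_def det_2 real_form_nth complex_eq_iff) (simp add: field_simps)

lemma SU11_real_form:
  fixes A :: "complex^2^2"
  assumes "A \<in> SU11"
  obtains k l m n where "A = real_form k l m n" "k * n - l * m = 1"
    "k = Re (A $ 1 $ 1 + A $ 1 $ 2)" "l = - Im (A $ 1 $ 1 - A $ 1 $ 2)"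
    "m = Im (A $ 1 $ 1 + A $ 1 $ 2)"
proof -
  let ?k = "Re (A $ 1 $ 1 + A $ 1 $ 2)" and ?l = "- Im (A $ 1 $ 1 - A $ 1 $ 2)"
    and ?m = "Im (A $ 1 $ 1 + A $ 1 $ 2)" and ?n = "Re (A $ 1 $ 1 - A $ 1 $ 2)"
  have A: "A $ 2 $ 1 = cnj (A $ 1 $ 2)" "A $ 2 $ 2 = cnj (A $ 1 $ 1)" "det A = 1"
    using assms by (auto simp: SU11_def)
  have "A = real_form ?k ?l ?m ?n"
    by (simp add: vec_eq_iff forall_2 real_form_nth complex_eq_iff A)
  moreover have "?k * ?n - ?l * ?m = 1"
    using A(3) by (simp add: det_2 A(1,2) complex_eq_iff algebra_simps)
  ultimately show ?thesis by (rule that) auto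
qed

lemma continuous_real_form:
  fixes k l m n :: "real \<Rightarrow> real"
  assumes "continuous_on UNIV k" "continuous_on UNIV l" "continuous_on UNIV m" "continuous_on UNIV n"
  shows "continuous_on UNIV (\<lambda>x. real_form (k x) (l x) (m x) (n x))"
proof -
  have eq: "real_form k l m n = (\<chi> i j. if i = 1 then if j = 1 then Complex ((k + n) / 2) ((m - l) / 2)
        else Complex ((k - n) / 2) ((m + l) / 2)
      else if j = 1 then Complex ((k - n) / 2) (- ((m + l) / 2))
        else Complex ((k + n) / 2) (- ((m - l) / 2)))" for k l m n
    by (simp add: vec_eq_iff forall_2 real_form_nth)
  have comp: "continuous_on UNIV (\<lambda>x. if b then f x else g x)"
    if "continuous_on UNIV f" "continuous_on UNIV g" for b and f g :: "real \<Rightarrow> complex"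
    using that by (cases b) simp_all
  show ?thesis
    unfolding eq Complex_eq
    by (intro continuous_on_vec_lambda comp continuous_intros assms) auto
qed

text \<open>
  Close to the identity the parameters of all four factors are small if \<open>y\<close> is: the middle factors
  \<open>x = (k - 1) / y\<close> and \<open>y\<close> produce the entry \<open>k = 1 + x y\<close>, and at the identity the first factor
  cancels the third one. A product of three elementary matrices would not do, since it involves a
  division by an off-diagonal entry.
\<close>

lemma elementary_factorisation:
  assumes "k * n - l * m = 1" "k \<noteq> 0" "y \<noteq> 0"
  shows "real_form k l m n =
    real_form 1 0 ((m - y) / k) 1 ** real_form 1 ((k - 1) / y) 0 1 **
    real_form 1 0 y 1 ** real_form 1 ((l - (k - 1) / y) / k) 0 1"
proof -
  define s x w where "s = (m - y) / k" and "x = (k - 1) / y" and "w = (l - x) / k"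
  have 1: "1 + x * y = k" and 2: "s * k = m - y" and 3: "k * w = l - x"
    using assms(2,3) by (simp_all add: s_def x_def w_def)
  have 4: "s + (s * x + 1) * y = m"
  proof -
    have "s + (s * x + 1) * y = s * (1 + x * y) + y" by (simp add: algebra_simps)
    then show ?thesis using 1 2 by simp
  qed
  have 5: "m * w + (s * x + 1) = n"
  proof -
    have "k * (m * w + (s * x + 1)) = m * (k * w) + (s * k) * x + k" by (simp add: algebra_simps)
    also have "\<dots> = m * l - x * y + k" unfolding 2 3 by (simp add: algebra_simps)
    also have "\<dots> = k * n" using 1 assms(1) by (simp add: algebra_simps)
    finally show ?thesis using assms(2) by simp
  qed
  have "real_form 1 0 s 1 ** real_form 1 x 0 1 ** real_form 1 0 y 1 ** real_form 1 w 0 1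
      = real_form (1 + x * y) ((1 + x * y) * w + x) (s + (s * x + 1) * y)
          ((s + (s * x + 1) * y) * w + (s * x + 1))"
    by (simp add: real_form_mult)
  also have "\<dots> = real_form k l m n"
    unfolding 1 4 5 3 by simp
  finally show ?thesis by (simp add: s_def x_def w_def)
qed

text \<open>
  A homotopy between the constant loops at two points moves the base point along a path.
\<close>

lemma connected_of_simply_connected:
  fixes S :: "'a::topological_space set"
  assumes "simply_connected S"
  shows "connected S"
proof (rule path_connected_imp_connected)
  have "path_component S a b" if "a \<in> S" "b \<in> S" for a b
  proof -
    have "homotopic_loops S (\<lambda>_. a) (\<lambda>_. b)"
      using assms[unfolded simply_connected_def, rule_format, of "\<lambda>_. a" "\<lambda>_. b"] that
      by (auto simp: path_def path_image_def pathstart_def pathfinish_def)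
    from homotopic_loops_imp_path_component_value[OF this, of 0] show ?thesis by simp
  qed
  then show "path_connected S" by (simp add: path_connected_component)
qed

context universal_covering_group_SU11
begin

sublocale G: group Gt by (rule group_Gt)

text \<open>
  The elements \<open>a\<^sup>-\<^sup>n u a\<^sup>n\<close> converge to the identity, in the subspace topology of the carrier.
\<close>

definition contracts :: "'g \<Rightarrow> 'g \<Rightarrow> bool" where
  "contracts a u \<longleftrightarrow> (\<forall>T. openin (top_of_set (carrier Gt)) T \<longrightarrow> \<one>\<^bsub>Gt\<^esub> \<in> T \<longrightarrow>
     (\<exists>M. \<forall>n\<ge>M. inv\<^bsub>Gt\<^esub> (a [^]\<^bsub>Gt\<^esub> n) \<otimes>\<^bsub>Gt\<^esub> u \<otimes>\<^bsub>Gt\<^esub> (a [^]\<^bsub>Gt\<^esub> (n::nat)) \<in> T))"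

lemma p_mult: "\<lbrakk>g \<in> carrier Gt; h \<in> carrier Gt\<rbrakk> \<Longrightarrow> p (g \<otimes>\<^bsub>Gt\<^esub> h) = p g ** p h"
  using hom_p by (simp add: hom_def SU11_group_def)

lemma p_in: "g \<in> carrier Gt \<Longrightarrow> p g \<in> SU11"
  using hom_p by (auto simp: hom_def SU11_group_def)

lemma p_surj:
  assumes "A \<in> SU11"
  obtains a where "a \<in> carrier Gt" "p a = A"
proof -
  have "A \<in> p ` carrier Gt" using covering_space_imp_surjective[OF covering_p] assms by simp
  then show ?thesis by (rule imageE) (rule that, simp_all)
qed

lemma p_one: "p \<one>\<^bsub>Gt\<^esub> = mat 1"
proof -
  obtain a where a: "a \<in> carrier Gt" "p a = mat 1"
    using p_surj[of "mat 1"] real_form_in_SU11[of 1 1 0 0] real_form_one by auto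
  then show ?thesis using p_mult[OF a(1) G.one_closed] by simp
qed

lemma continuous_translate:
  assumes "a \<in> carrier Gt" "b \<in> carrier Gt"
  shows "continuous_on (carrier Gt) (\<lambda>g. a \<otimes>\<^bsub>Gt\<^esub> g \<otimes>\<^bsub>Gt\<^esub> b)"
proof -
  have mult: "continuous_on (carrier Gt) (\<lambda>g. x g \<otimes>\<^bsub>Gt\<^esub> y g)"
    if "continuous_on (carrier Gt) x" "continuous_on (carrier Gt) y"
      "x ` carrier Gt \<subseteq> carrier Gt" "y ` carrier Gt \<subseteq> carrier Gt" for x y
  proof -
    have "continuous_on (carrier Gt) (\<lambda>g. (\<lambda>(x, y). x \<otimes>\<^bsub>Gt\<^esub> y) (x g, y g))"
      by (rule continuous_on_compose2[OF continuous_mult continuous_on_Pair[OF that(1,2)]])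
        (use that(3,4) in auto)
    then show ?thesis by simp
  qed
  show ?thesis
    by (intro mult continuous_on_id continuous_on_const) (use assms in auto)
qed

lemma square_neighbourhood:
  assumes "openin (top_of_set (carrier Gt)) T" "\<one>\<^bsub>Gt\<^esub> \<in> T"
  obtains T' where "openin (top_of_set (carrier Gt)) T'" "\<one>\<^bsub>Gt\<^esub> \<in> T'"
    "\<And>x y. \<lbrakk>x \<in> T'; y \<in> T'\<rbrakk> \<Longrightarrow> x \<otimes>\<^bsub>Gt\<^esub> y \<in> T"
proof -
  let ?C = "carrier Gt"
  obtain O1 where O1: "open O1" "T = ?C \<inter> O1" using assms(1) by (auto simp: openin_open)
  have "openin (top_of_set (?C \<times> ?C)) ((?C \<times> ?C) \<inter> (\<lambda>(x, y). x \<otimes>\<^bsub>Gt\<^esub> y) -` O1)"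
    using continuous_openin_preimage_gen[OF continuous_mult O1(1)] .
  then obtain W where W: "open W" "(?C \<times> ?C) \<inter> (\<lambda>(x, y). x \<otimes>\<^bsub>Gt\<^esub> y) -` O1 = (?C \<times> ?C) \<inter> W"
    by (auto simp: openin_open)
  have "(\<one>\<^bsub>Gt\<^esub>, \<one>\<^bsub>Gt\<^esub>) \<in> (?C \<times> ?C) \<inter> (\<lambda>(x, y). x \<otimes>\<^bsub>Gt\<^esub> y) -` O1"
    using assms(2) O1(2) by simp
  then have "(\<one>\<^bsub>Gt\<^esub>, \<one>\<^bsub>Gt\<^esub>) \<in> W" unfolding W(2) by blast
  from open_prod_elim[OF W(1) this] obtain A B
    where AB: "open A" "open B" "(\<one>\<^bsub>Gt\<^esub>, \<one>\<^bsub>Gt\<^esub>) \<in> A \<times> B" "A \<times> B \<subseteq> W" by blast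
  show ?thesis
  proof
    show "openin (top_of_set ?C) (?C \<inter> (A \<inter> B))" using AB by (auto simp: openin_open)
    show "\<one>\<^bsub>Gt\<^esub> \<in> ?C \<inter> (A \<inter> B)" using AB by simp
    fix x y assume "x \<in> ?C \<inter> (A \<inter> B)" "y \<in> ?C \<inter> (A \<inter> B)"
    then have "x \<in> ?C" "y \<in> ?C" "(x, y) \<in> (?C \<times> ?C) \<inter> W" using AB(4) by auto
    then show "x \<otimes>\<^bsub>Gt\<^esub> y \<in> T" unfolding W(2)[symmetric] O1(2) by simp
  qed
qed

text \<open>
  Membership in \<open>N\<close> is constant on every left translate of \<open>V\<close>, hence locally constant on the connected
  group.
\<close>

lemma open_subgroup_is_everything:
  assumes N: "subgroup N Gt" and V: "openin (top_of_set (carrier Gt)) V" "\<one>\<^bsub>Gt\<^esub> \<in> V" "V \<subseteq> N"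
  shows "N = carrier Gt"
proof -
  interpret N: subgroup N Gt by (rule N)
  have "g \<in> N" if g: "g \<in> carrier Gt" for g
  proof (rule connected_induction_simple[of "carrier Gt" "\<one>\<^bsub>Gt\<^esub>" g "\<lambda>g. g \<in> N"])
    show "connected (carrier Gt)"
      by (rule connected_of_simply_connected[OF simply_connected_Gt])
    fix a assume a: "a \<in> carrier Gt"
    let ?T = "carrier Gt \<inter> (\<lambda>x. inv\<^bsub>Gt\<^esub> a \<otimes>\<^bsub>Gt\<^esub> x \<otimes>\<^bsub>Gt\<^esub> \<one>\<^bsub>Gt\<^esub>) -` V"
    have "openin (top_of_set (carrier Gt)) ?T"
      using continuous_translate[of "inv\<^bsub>Gt\<^esub> a" "\<one>\<^bsub>Gt\<^esub>"] a V(1)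
      by (intro continuous_openin_preimage[of _ _ "carrier Gt"]) auto
    moreover have "a \<in> ?T" using a V(2) by simp
    moreover have "y \<in> N" if "x \<in> ?T" "y \<in> ?T" "x \<in> N" for x y
    proof -
      have xy: "x \<in> carrier Gt" "y \<in> carrier Gt"
        and V': "inv\<^bsub>Gt\<^esub> a \<otimes>\<^bsub>Gt\<^esub> x \<in> N" "inv\<^bsub>Gt\<^esub> a \<otimes>\<^bsub>Gt\<^esub> y \<in> N"
        using that a V(3) by auto
      define z w where "z = inv\<^bsub>Gt\<^esub> a \<otimes>\<^bsub>Gt\<^esub> x" and "w = inv\<^bsub>Gt\<^esub> a \<otimes>\<^bsub>Gt\<^esub> y"
      have zw: "z \<in> carrier Gt" "w \<in> carrier Gt" using xy a by (auto simp: z_def w_def)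
      have "a \<otimes>\<^bsub>Gt\<^esub> z = x" and y: "a \<otimes>\<^bsub>Gt\<^esub> w = y"
        using xy a by (simp_all add: z_def w_def G.m_assoc[symmetric])
      then have "a = x \<otimes>\<^bsub>Gt\<^esub> inv\<^bsub>Gt\<^esub> z" using a zw xy G.inv_solve_right by metis
      then have y_eq: "y = x \<otimes>\<^bsub>Gt\<^esub> inv\<^bsub>Gt\<^esub> z \<otimes>\<^bsub>Gt\<^esub> w" using y by simp
      have "z \<in> N" "w \<in> N" using V' by (simp_all add: z_def w_def)
      then show "y \<in> N"
        unfolding y_eq using that(3) by (intro N.m_closed N.m_inv_closed)
    qed
    ultimately show "\<exists>T. openin (top_of_set (carrier Gt)) T \<and> a \<in> T \<and>
        (\<forall>x\<in>T. \<forall>y\<in>T. x \<in> N \<longrightarrow> y \<in> N)" by blast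
  qed (use g in auto)
  then show ?thesis using N.subset by blast
qed

text \<open>
  Here \<open>q\<close> is the local inverse of the covering at the identity, \<open>X\<close> a curve through the identity that
  conjugation by \<open>p a\<close> contracts by the factor \<open>4\<close>. The element \<open>a\<close> is fixed, so conjugation by \<open>a\<close> takes a
  sufficiently small neighbourhood of the identity into the domain \<open>T\<close> on which \<open>p\<close> is injective; there
  the contraction of \<open>X\<close> lifts to one of \<open>q \<circ> X\<close>.
\<close>

lemma contracted_local_lifts:
  fixes X :: "real \<Rightarrow> complex^2^2"
  assumes T: "openin (top_of_set (carrier Gt)) T" "\<one>\<^bsub>Gt\<^esub> \<in> T"
    and u: "openin (top_of_set SU11) u" and hom: "homeomorphism T u p q"
    and X: "continuous_on UNIV X" "X 0 = mat 1" "\<And>x. X x \<in> SU11"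
    and a: "a \<in> carrier Gt" and conj: "\<And>x. X x ** p a = p a ** X (x / 4)"
    and T': "openin (top_of_set (carrier Gt)) T'" "\<one>\<^bsub>Gt\<^esub> \<in> T'"
  shows "\<exists>\<delta>>0. \<forall>x. \<bar>x\<bar> < \<delta> \<longrightarrow>
    X x \<in> u \<and> q (X x) \<in> T \<inter> T' \<and> p (q (X x)) = X x \<and> contracts a (q (X x))"
proof -
  have pq: "\<And>A. A \<in> u \<Longrightarrow> p (q A) = A \<and> q A \<in> T" and qp: "\<And>g. g \<in> T \<Longrightarrow> q (p g) = g \<and> p g \<in> u"
    and q_cont: "continuous_on u q"
    using hom by (auto simp: homeomorphism_def)
  have TC: "T \<subseteq> carrier Gt" using T(1) openin_imp_subset by blast
  have near: "\<exists>\<delta>>0. \<forall>x. \<bar>x\<bar> < \<delta> \<longrightarrow> X x \<in> u \<and> q (X x) \<in> S"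
    if S: "openin (top_of_set (carrier Gt)) S" "\<one>\<^bsub>Gt\<^esub> \<in> S" for S
  proof -
    obtain O1 where O1: "open O1" "S = carrier Gt \<inter> O1" using S(1) by (auto simp: openin_open)
    have "openin (top_of_set u) (u \<inter> q -` O1)"
      using continuous_openin_preimage_gen[OF q_cont O1(1)] .
    then have "openin (top_of_set SU11) (u \<inter> q -` O1)" using u openin_trans by blast
    then obtain O2 where O2: "open O2" "u \<inter> q -` O1 = SU11 \<inter> O2" by (auto simp: openin_open)
    have "mat 1 \<in> u \<inter> q -` O1" using qp[OF T(2)] p_one S(2) O1(2) by auto
    then have "0 \<in> X -` O2" unfolding O2(2) using X(2) by simp
    moreover have "open (X -` O2)" using open_vimage[OF O2(1) X(1)] .
    ultimately obtain \<delta> where \<delta>: "\<delta> > 0" "ball 0 \<delta> \<subseteq> X -` O2" using open_contains_ball by blast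
    have "X x \<in> u \<and> q (X x) \<in> S" if "\<bar>x\<bar> < \<delta>" for x
    proof -
      have "X x \<in> SU11 \<inter> O2" using that \<delta>(2) X(3) by (auto simp: dist_real_def)
      then have "X x \<in> u" "q (X x) \<in> O1" unfolding O2(2)[symmetric] by auto
      then show ?thesis using pq TC O1(2) by blast
    qed
    then show ?thesis using \<delta>(1) by blast
  qed
  let ?c = "\<lambda>g. inv\<^bsub>Gt\<^esub> a \<otimes>\<^bsub>Gt\<^esub> g \<otimes>\<^bsub>Gt\<^esub> a"
  have "openin (top_of_set (carrier Gt)) (carrier Gt \<inter> ?c -` T)"
    using continuous_translate[of "inv\<^bsub>Gt\<^esub> a" a] a T(1)
    by (intro continuous_openin_preimage[of _ _ "carrier Gt"]) auto
  then have "openin (top_of_set (carrier Gt)) (T' \<inter> (carrier Gt \<inter> ?c -` T))"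
    using T'(1) by blast
  moreover have "\<one>\<^bsub>Gt\<^esub> \<in> T' \<inter> (carrier Gt \<inter> ?c -` T)" using T'(2) T(2) a by simp
  ultimately obtain \<delta> where \<delta>: "\<delta> > 0"
    "\<And>x. \<bar>x\<bar> < \<delta> \<Longrightarrow> X x \<in> u \<and> q (X x) \<in> T' \<inter> (carrier Gt \<inter> ?c -` T)"
    using near by metis
  \<comment> \<open>a conjugate of a small lift stays in the domain of injectivity of \<open>p\<close>, hence is the lift of
    the conjugate\<close>
  have step: "?c (q (X x)) = q (X (x / 4))" if x: "\<bar>x\<bar> < \<delta>" for x
  proof -
    have qx: "q (X x) \<in> carrier Gt" "?c (q (X x)) \<in> T" "p (q (X x)) = X x"
      using \<delta>(2)[OF x] pq by auto
    have "p (inv\<^bsub>Gt\<^esub> a) ** p a = mat 1"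
      using p_mult[of "inv\<^bsub>Gt\<^esub> a" a] a p_one by simp
    then have "p (?c (q (X x))) = X (x / 4)"
      using a qx conj[of x] by (simp add: p_mult matrix_mul_assoc[symmetric]) (simp add: matrix_mul_assoc)
    then show ?thesis using qp[OF qx(2)] by simp
  qed
  have iterate: "inv\<^bsub>Gt\<^esub> (a [^]\<^bsub>Gt\<^esub> n) \<otimes>\<^bsub>Gt\<^esub> q (X x) \<otimes>\<^bsub>Gt\<^esub> (a [^]\<^bsub>Gt\<^esub> n) = q (X (x / 4 ^ n))"
    if x: "\<bar>x\<bar> < \<delta>" for x and n :: nat
  proof (induction n)
    case 0
    then show ?case using \<delta>(2)[OF x] by simp
  next
    case (Suc n)
    have small: "\<bar>x / 4 ^ n\<bar> < \<delta>"
    proof -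
      have "\<bar>x\<bar> / 4 ^ n \<le> \<bar>x\<bar>" by (simp add: divide_le_eq mult_left_mono[of 1 "4 ^ n" "\<bar>x\<bar>", simplified])
      then show ?thesis using x by simp
    qed
    have qx: "q (X x) \<in> carrier Gt" using \<delta>(2)[OF x] by auto
    have "inv\<^bsub>Gt\<^esub> (a [^]\<^bsub>Gt\<^esub> Suc n) \<otimes>\<^bsub>Gt\<^esub> q (X x) \<otimes>\<^bsub>Gt\<^esub> (a [^]\<^bsub>Gt\<^esub> Suc n)
        = ?c (inv\<^bsub>Gt\<^esub> (a [^]\<^bsub>Gt\<^esub> n) \<otimes>\<^bsub>Gt\<^esub> q (X x) \<otimes>\<^bsub>Gt\<^esub> (a [^]\<^bsub>Gt\<^esub> n))"
      using a qx by (simp add: G.inv_mult_group G.m_assoc)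
    also have "\<dots> = q (X (x / 4 ^ Suc n))"
      using Suc.IH step[OF small] by (simp add: mult.commute)
    finally show ?case .
  qed
  have "contracts a (q (X x))" if x: "\<bar>x\<bar> < \<delta>" for x
    unfolding contracts_def
  proof (intro allI impI)
    fix S assume S: "openin (top_of_set (carrier Gt)) S" "\<one>\<^bsub>Gt\<^esub> \<in> S"
    obtain \<eta> where \<eta>: "\<eta> > 0" "\<And>x. \<bar>x\<bar> < \<eta> \<Longrightarrow> q (X x) \<in> S" using near[OF S] by metis
    have "(\<lambda>n. x * (1 / 4) ^ n) \<longlonglongrightarrow> x * 0"
      by (intro tendsto_mult tendsto_const LIMSEQ_power_zero) auto
    then have "(\<lambda>n. x / 4 ^ n) \<longlonglongrightarrow> 0" by (simp add: power_divide)
    from LIMSEQ_D[OF this \<eta>(1)] have "\<exists>M. \<forall>n\<ge>M. \<bar>x / 4 ^ n\<bar> < \<eta>"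
      by (simp only: diff_0_right real_norm_def)
    then show "\<exists>M. \<forall>n\<ge>M. inv\<^bsub>Gt\<^esub> (a [^]\<^bsub>Gt\<^esub> n) \<otimes>\<^bsub>Gt\<^esub> q (X x) \<otimes>\<^bsub>Gt\<^esub> (a [^]\<^bsub>Gt\<^esub> (n::nat)) \<in> S"
      unfolding iterate[OF x] using \<eta>(2) by blast
  qed
  moreover have "X x \<in> u \<and> q (X x) \<in> T \<inter> T' \<and> p (q (X x)) = X x" if x: "\<bar>x\<bar> < \<delta>" for x
    using \<delta>(2)[OF x] pq by auto
  ultimately show ?thesis using \<delta>(1) by (intro exI[of _ \<delta>]) simp
qed

text \<open>
  The two elementary one-parameter groups of \<open>SL(2,\<real>)\<close> are contracted by \<open>diag(2, 1/2)\<close> and by its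
  inverse. The lifts of their small elements thus lie in \<open>N\<close>, and by the factorisation into
  elementary matrices their products contain a neighbourhood of the identity. All factors are kept in \<open>T2\<close>,
  so that the product stays in \<open>T\<close> and is determined by its image under \<open>p\<close>.
\<close>

theorem contracted_elements_generate:
  assumes N: "subgroup N Gt"
    and contr: "\<And>a u. \<lbrakk>a \<in> carrier Gt; u \<in> carrier Gt; contracts a u\<rbrakk> \<Longrightarrow> u \<in> N"
  shows "N = carrier Gt"
proof -
  interpret N: subgroup N Gt by (rule N)
  let ?C = "carrier Gt"
  define U where "U x = real_form 1 x 0 1" for x
  define L where "L x = real_form 1 0 x 1" for x
  obtain T u q where T: "\<one>\<^bsub>Gt\<^esub> \<in> T" "openin (top_of_set ?C) T"
    and u: "openin (top_of_set SU11) u" and hom: "homeomorphism T u p q"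
    using covering_space_local_homeomorphism[OF covering_p G.one_closed] by metis
  have qp: "\<And>g. g \<in> T \<Longrightarrow> q (p g) = g" using hom by (simp add: homeomorphism_def)
  have TC: "T \<subseteq> ?C" using T(2) openin_imp_subset by blast
  obtain T1 where T1: "openin (top_of_set ?C) T1" "\<one>\<^bsub>Gt\<^esub> \<in> T1"
    "\<And>x y. \<lbrakk>x \<in> T1; y \<in> T1\<rbrakk> \<Longrightarrow> x \<otimes>\<^bsub>Gt\<^esub> y \<in> T"
    using square_neighbourhood[OF T(2,1)] by metis
  obtain T2 where T2: "openin (top_of_set ?C) T2" "\<one>\<^bsub>Gt\<^esub> \<in> T2"
    "\<And>x y. \<lbrakk>x \<in> T2; y \<in> T2\<rbrakk> \<Longrightarrow> x \<otimes>\<^bsub>Gt\<^esub> y \<in> T1"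
    using square_neighbourhood[OF T1(1,2)] by metis
  obtain a where a: "a \<in> ?C" "p a = real_form 2 0 0 (1/2)"
    using p_surj[OF real_form_in_SU11[of 2 "1/2" 0 0]] by auto
  obtain b where b: "b \<in> ?C" "p b = real_form (1/2) 0 0 2"
    using p_surj[OF real_form_in_SU11[of "1/2" 2 0 0]] by auto
  have "\<exists>\<delta>>0. \<forall>x. \<bar>x\<bar> < \<delta> \<longrightarrow> U x \<in> u \<and> q (U x) \<in> T \<inter> T2 \<and> p (q (U x)) = U x \<and> contracts a (q (U x))"
    by (rule contracted_local_lifts[OF T(2,1) u hom _ _ _ a(1) _ T2(1,2)])
      (auto simp: U_def a(2) real_form_mult real_form_one real_form_in_SU11
        intro!: continuous_real_form continuous_intros)
  then obtain \<delta>1 where \<delta>1: "\<delta>1 > 0"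
    "\<And>x. \<bar>x\<bar> < \<delta>1 \<Longrightarrow> q (U x) \<in> T \<inter> T2 \<and> p (q (U x)) = U x \<and> contracts a (q (U x))" by metis
  have "\<exists>\<delta>>0. \<forall>x. \<bar>x\<bar> < \<delta> \<longrightarrow> L x \<in> u \<and> q (L x) \<in> T \<inter> T2 \<and> p (q (L x)) = L x \<and> contracts b (q (L x))"
    by (rule contracted_local_lifts[OF T(2,1) u hom _ _ _ b(1) _ T2(1,2)])
      (auto simp: L_def b(2) real_form_mult real_form_one real_form_in_SU11
        intro!: continuous_real_form continuous_intros)
  then obtain \<delta>2 where \<delta>2: "\<delta>2 > 0"
    "\<And>x. \<bar>x\<bar> < \<delta>2 \<Longrightarrow> q (L x) \<in> T \<inter> T2 \<and> p (q (L x)) = L x \<and> contracts b (q (L x))" by metis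
  define \<delta> where "\<delta> = min \<delta>1 \<delta>2"
  have \<delta>: "\<delta> > 0" using \<delta>1(1) \<delta>2(1) by (simp add: \<delta>_def)
  have qU: "q (U x) \<in> T2 \<inter> N \<inter> ?C \<and> p (q (U x)) = U x" if "\<bar>x\<bar> < \<delta>" for x
    using \<delta>1(2)[of x] contr[OF a(1)] that TC by (auto simp: \<delta>_def)
  have qL: "q (L x) \<in> T2 \<inter> N \<inter> ?C \<and> p (q (L x)) = L x" if "\<bar>x\<bar> < \<delta>" for x
    using \<delta>2(2)[of x] contr[OF b(1)] that TC by (auto simp: \<delta>_def)
  define y where "y = \<delta> / 2"
  have y: "y \<noteq> 0" "\<bar>y\<bar> < \<delta>" using \<delta> by (auto simp: y_def)
  define k l m where "k A = Re (A $ 1 $ 1 + A $ 1 $ 2)" and "l A = - Im (A $ 1 $ 1 - A $ 1 $ 2)"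
    and "m A = Im (A $ 1 $ 1 + A $ 1 $ 2)" for A :: "complex^2^2"
  have klm_1: "k (mat 1) = 1" "l (mat 1) = 0" "m (mat 1) = 0"
    by (simp_all add: k_def l_def m_def mat_def)
  have klm_lim: "(k \<longlongrightarrow> 1) (nhds (mat 1))" "(l \<longlongrightarrow> 0) (nhds (mat 1))" "(m \<longlongrightarrow> 0) (nhds (mat 1))"
  proof -
    have "continuous_on UNIV k" "continuous_on UNIV l" "continuous_on UNIV m"
      unfolding k_def l_def m_def by (intro continuous_intros)+
    then have "isCont k (mat 1)" "isCont l (mat 1)" "isCont m (mat 1)"
      by (simp_all add: continuous_on_eq_continuous_at)
    then show "(k \<longlongrightarrow> 1) (nhds (mat 1))" "(l \<longlongrightarrow> 0) (nhds (mat 1))" "(m \<longlongrightarrow> 0) (nhds (mat 1))"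
      using klm_1 unfolding isCont_def tendsto_at_iff_tendsto_nhds by simp_all
  qed
  have lims: "((\<lambda>A. (m A - y) / k A) \<longlongrightarrow> (0 - y) / 1) (nhds (mat 1))"
    "((\<lambda>A. (k A - 1) / y) \<longlongrightarrow> (1 - 1) / y) (nhds (mat 1))"
    "((\<lambda>A. (l A - (k A - 1) / y) / k A) \<longlongrightarrow> (0 - (1 - 1) / y) / 1) (nhds (mat 1))"
    using y(1) by (intro tendsto_intros klm_lim; simp)+
  have small: "eventually (\<lambda>A. \<bar>f A\<bar> < \<delta>) (nhds (mat 1))"
    if "(f \<longlongrightarrow> c) (nhds (mat 1))" "\<bar>c\<bar> < \<delta>" for f :: "complex^2^2 \<Rightarrow> real" and c
    using order_tendstoD(2)[OF tendsto_rabs[OF that(1)] that(2)] .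
  have "eventually (\<lambda>A. k A > 0 \<and> \<bar>(m A - y) / k A\<bar> < \<delta> \<and> \<bar>(k A - 1) / y\<bar> < \<delta> \<and>
      \<bar>(l A - (k A - 1) / y) / k A\<bar> < \<delta>) (nhds (mat 1))"
    using y \<delta> by (intro eventually_conj small[OF lims(1)] small[OF lims(2)] small[OF lims(3)]
        order_tendstoD(1)[OF klm_lim(1)]) auto
  then obtain W where W: "open W" "mat 1 \<in> W"
    "\<And>A. A \<in> W \<Longrightarrow> k A > 0 \<and> \<bar>(m A - y) / k A\<bar> < \<delta> \<and> \<bar>(k A - 1) / y\<bar> < \<delta> \<and>
      \<bar>(l A - (k A - 1) / y) / k A\<bar> < \<delta>"
    unfolding eventually_nhds by blast
  define V where "V = T \<inter> (?C \<inter> p -` W)"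
  have "openin (top_of_set ?C) (?C \<inter> p -` W)"
    using continuous_openin_preimage_gen[OF covering_space_imp_continuous[OF covering_p] W(1)] .
  then have "openin (top_of_set ?C) V" unfolding V_def using T(2) by blast
  moreover have "\<one>\<^bsub>Gt\<^esub> \<in> V" using T(1) W(2) p_one by (simp add: V_def)
  moreover have "V \<subseteq> N"
  proof
    fix g assume "g \<in> V"
    then have g: "g \<in> T" "g \<in> ?C" "p g \<in> W" by (auto simp: V_def)
    obtain k' l' m' n' where A: "p g = real_form k' l' m' n'" "k' * n' - l' * m' = 1"
      "k' = k (p g)" "l' = l (p g)" "m' = m (p g)"
      using SU11_real_form[OF p_in[OF g(2)]] unfolding k_def l_def m_def by metis
    define x1 x2 x3 where "x1 = (m' - y) / k'" and "x2 = (k' - 1) / y"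
      and "x3 = (l' - (k' - 1) / y) / k'"
    have x: "\<bar>x1\<bar> < \<delta>" "\<bar>x2\<bar> < \<delta>" "\<bar>x3\<bar> < \<delta>" "k' \<noteq> 0"
      using W(3)[OF g(3)] unfolding A(3-5)[symmetric] x1_def x2_def x3_def by auto
    define h where "h = (q (L x1) \<otimes>\<^bsub>Gt\<^esub> q (U x2)) \<otimes>\<^bsub>Gt\<^esub> (q (L y) \<otimes>\<^bsub>Gt\<^esub> q (U x3))"
    note q4 = qL[OF x(1)] qU[OF x(2)] qL[OF y(2)] qU[OF x(3)]
    have "h \<in> T" unfolding h_def using q4 by (intro T1(3) T2(3)) auto
    have "h \<in> N" unfolding h_def using q4 by (intro N.m_closed) auto
    have "p h = L x1 ** U x2 ** (L y ** U x3)"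
      unfolding h_def using q4 by (auto simp: p_mult)
    also have "\<dots> = L x1 ** U x2 ** L y ** U x3" by (rule matrix_mul_assoc)
    also have "\<dots> = real_form k' l' m' n'"
      unfolding L_def U_def x1_def x2_def x3_def
      by (rule elementary_factorisation[OF A(2) x(4) y(1), symmetric])
    also have "\<dots> = p g" by (rule A(1)[symmetric])
    finally have pp: "p h = p g" .
    have "h = q (p h)" by (rule qp[OF \<open>h \<in> T\<close>, symmetric])
    also have "\<dots> = g" unfolding pp by (rule qp[OF g(1)])
    finally show "g \<in> N" using \<open>h \<in> N\<close> by metis
  qed
  ultimately show ?thesis by (rule open_subgroup_is_everything[OF N])
qed

end


section \<open>Self-adjoint holomorphic endomorphisms of a homogeneous bundle\<close>

text \<open>
  Bolzano-Weierstrass: consecutive members of a convergent subsequence come close to each other.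
\<close>

lemma bounded_family_recurrence:
  fixes x :: "nat \<Rightarrow> 'a::countable \<Rightarrow> complex"
  assumes I: "finite I" and K: "\<And>n i. i \<in> I \<Longrightarrow> norm (x n i) \<le> K" and \<epsilon>: "\<epsilon> > 0"
  shows "\<exists>m n. m < n \<and> L2_set (\<lambda>i. norm (x n i - x m i)) I < \<epsilon>"
proof -
  define y where "y n = (\<lambda>i. if i \<in> I then x n i else 0)" for n
  define S :: "('a \<Rightarrow> complex) set" where "S = PiE UNIV (\<lambda>_. cball 0 (max K 0))"
  have "compactin (product_topology (\<lambda>_. euclidean) UNIV) S"
    unfolding S_def by (simp add: compactin_PiE)
  then have "compact S" by (simp add: euclidean_product_topology)
  moreover have "\<forall>n. y n \<in> S" using K by (auto simp: S_def y_def le_max_iff_disj)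
  ultimately obtain l r where r: "strict_mono (r :: nat \<Rightarrow> nat)" "(y \<circ> r) \<longlonglongrightarrow> l"
    unfolding compact_eq_seq_compact_metric seq_compact_def by metis
  have "(\<lambda>k. y (r k) i) \<longlonglongrightarrow> l i" for i
  proof -
    have "isCont (\<lambda>f. f i) l"
      using continuous_on_product_coordinates[of i] continuous_on_eq_continuous_at[OF open_UNIV] by blast
    from isCont_tendsto_compose[OF this r(2)] show ?thesis by (simp add: o_def)
  qed
  then have "(\<lambda>k. L2_set (\<lambda>i. norm (y (r (Suc k)) i - y (r k) i)) I)
      \<longlonglongrightarrow> sqrt (\<Sum>i\<in>I. (norm (l i - l i))\<^sup>2)"
    unfolding L2_set_def by (intro tendsto_intros) (auto intro: LIMSEQ_Suc)
  then have "(\<lambda>k. L2_set (\<lambda>i. norm (y (r (Suc k)) i - y (r k) i)) I) \<longlonglongrightarrow> 0" by simp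
  from order_tendstoD(2)[OF this \<epsilon>]
  obtain k where "L2_set (\<lambda>i. norm (y (r (Suc k)) i - y (r k) i)) I < \<epsilon>"
    by (auto simp: eventually_sequentially)
  moreover have "L2_set (\<lambda>i. norm (y (r (Suc k)) i - y (r k) i)) I
      = L2_set (\<lambda>i. norm (x (r (Suc k)) i - x (r k) i)) I"
    by (intro L2_set_cong) (auto simp: y_def)
  moreover have "r k < r (Suc k)" using r(1) by (simp add: strict_mono_def)
  ultimately show ?thesis by metis
qed

lemma holomorphic_real_constant:
  assumes "f holomorphic_on unit_disc" "\<And>z. z \<in> unit_disc \<Longrightarrow> f z \<in> \<real>" "z \<in> unit_disc"
  shows "f z = f 0"
proof -
  have "f constant_on unit_disc"
  proof (rule ccontr)
    assume "\<not> f constant_on unit_disc"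
    then have op: "open (f ` unit_disc)"
      by (rule open_mapping_thm[OF assms(1) open_ball connected_ball open_ball order_refl])
    have "f 0 \<in> f ` unit_disc" by simp
    with op obtain e where e: "e > 0" "ball (f 0) e \<subseteq> f ` unit_disc"
      using open_contains_ball by blast
    have "f 0 + \<i> * of_real (e / 2) \<in> ball (f 0) e" using e(1) by (simp add: dist_norm norm_mult)
    with e(2) have "f 0 + \<i> * of_real (e / 2) \<in> f ` unit_disc" by (rule subsetD)
    then have "f 0 + \<i> * of_real (e / 2) \<in> \<real>" by (rule imageE) (simp only: assms(2))
    then have "Im (f 0 + \<i> * of_real (e / 2)) = 0" by (simp add: complex_is_Real_iff)
    moreover have "Im (f 0) = 0" using assms(2)[of 0] by (simp add: complex_is_Real_iff)
    ultimately show False using e(1) by simp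
  qed
  then show ?thesis using assms(3) by (fastforce simp: constant_on_def)
qed

locale self_adjoint_endomorphism =
  universal_covering_group_SU11 Gt p + homogeneous_bundle Gt p act E
  for Gt :: "('g::topological_space) monoid" and p :: "'g \<Rightarrow> complex^2^2"
    and act :: "'g \<Rightarrow> 'e \<Rightarrow> 'e" and E :: "'e vbundle" +
  fixes P :: "'e \<Rightarrow> 'e"
  assumes P_holomorphic: "holomorphic_bundle_map E E (\<lambda>z. z) P"
    and P_self_adjoint: "\<lbrakk>e \<in> fibre E z; f \<in> fibre E z\<rbrakk> \<Longrightarrow> herm E (P e) f = herm E e (P f)"
begin

abbreviation move :: "'g \<Rightarrow> complex \<Rightarrow> complex" where "move g \<equiv> disc_action (p g)"

lemma E: "hermitian_holomorphic_bundle E" by unfold_locales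

lemma move_disc: "\<lbrakk>g \<in> carrier Gt; z \<in> unit_disc\<rbrakk> \<Longrightarrow> move g z \<in> unit_disc"
  by (rule holomorphic_bundle_mapD(2)[OF act_holomorphic])

lemma act_linear: "\<lbrakk>g \<in> carrier Gt; z \<in> unit_disc\<rbrakk> \<Longrightarrow> fibre_linear E E z (move g z) (act g)"
  by (rule holomorphic_bundle_mapD(3)[OF act_holomorphic])

lemma act_fibre: "\<lbrakk>g \<in> carrier Gt; e \<in> fibre E z\<rbrakk> \<Longrightarrow> act g e \<in> fibre E (move g z)"
  using fibre_linearD(1)[OF act_linear] fibre_in_disc[OF E] by blast

lemma fibre_Total: "e \<in> fibre E z \<Longrightarrow> e \<in> Total E" by (simp add: fibre_def)

lemma act_Total: "\<lbrakk>g \<in> carrier Gt; e \<in> Total E\<rbrakk> \<Longrightarrow> act g e \<in> Total E"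
  using fibre_Total[OF act_fibre[OF _ Total_in_fibre]] .

lemma act_inv:
  assumes "g \<in> carrier Gt" "e \<in> Total E"
  shows "act (inv\<^bsub>Gt\<^esub> g) (act g e) = e" "act g (act (inv\<^bsub>Gt\<^esub> g) e) = e"
  using act_mult[of "inv\<^bsub>Gt\<^esub> g" g e] act_mult[of g "inv\<^bsub>Gt\<^esub> g" e] act_one[of e] assms by simp_all

lemma move_inv:
  assumes g: "g \<in> carrier Gt" and z: "z \<in> unit_disc"
  shows "move g (move (inv\<^bsub>Gt\<^esub> g) z) = z" "move (inv\<^bsub>Gt\<^esub> g) (move g z) = z"
proof -
  obtain \<phi> where "fibre_coords E z \<phi>" using chart_at[OF E z] by blast
  then obtain e where e: "e \<in> fibre E z"
    using vector_with_coords[of E z \<phi> "\<lambda>i. 0"] by (auto simp: Cn_def)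
  have "act g (act (inv\<^bsub>Gt\<^esub> g) e) \<in> fibre E (move g (move (inv\<^bsub>Gt\<^esub> g) z))"
    using act_fibre g e by blast
  then show "move g (move (inv\<^bsub>Gt\<^esub> g) z) = z"
    using act_inv(2)[OF g fibre_Total[OF e]] e by (simp add: fibre_def)
  have "act (inv\<^bsub>Gt\<^esub> g) (act g e) \<in> fibre E (move (inv\<^bsub>Gt\<^esub> g) (move g z))"
    using act_fibre g e by blast
  then show "move (inv\<^bsub>Gt\<^esub> g) (move g z) = z"
    using act_inv(1)[OF g fibre_Total[OF e]] e by (simp add: fibre_def)
qed

text \<open>
  The conjugate \<open>g P g\<^sup>-\<^sup>1\<close>. It covers the identity of the disc, and the given conditions on \<open>P\<close> carry over to
  it.
\<close>

definition twist :: "'g \<Rightarrow> 'e \<Rightarrow> 'e" where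
  "twist g e = act g (P (act (inv\<^bsub>Gt\<^esub> g) e))"

lemma P_fibre: "e \<in> fibre E z \<Longrightarrow> P e \<in> fibre E z"
  using fibre_linearD(1)[OF holomorphic_bundle_mapD(3)[OF P_holomorphic]] fibre_in_disc[OF E] by blast

lemma twist_one: "e \<in> Total E \<Longrightarrow> twist \<one>\<^bsub>Gt\<^esub> e = P e"
  using act_one[of e] act_one[OF fibre_Total[OF P_fibre[OF Total_in_fibre]], of e]
  by (simp add: twist_def)

lemma twist_holomorphic:
  assumes g: "g \<in> carrier Gt"
  shows "holomorphic_bundle_map E E (\<lambda>z. z) (twist g)"
proof -
  have "holomorphic_bundle_map E E (\<lambda>z. move g (move (inv\<^bsub>Gt\<^esub> g) z))
      (\<lambda>e. act g (P (act (inv\<^bsub>Gt\<^esub> g) e)))"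
    using holomorphic_bundle_map_compose[OF E E E
        holomorphic_bundle_map_compose[OF E E E act_holomorphic[OF G.inv_closed[OF g]] P_holomorphic]
        act_holomorphic[OF g]] .
  then show ?thesis
    by (rule holomorphic_bundle_map_cong[OF E]) (simp_all add: move_inv(1)[OF g] twist_def)
qed

lemma twist_linear: "\<lbrakk>g \<in> carrier Gt; z \<in> unit_disc\<rbrakk> \<Longrightarrow> fibre_linear E E z z (twist g)"
  by (rule holomorphic_bundle_mapD(3)[OF twist_holomorphic])

lemma twist_fibre: "\<lbrakk>g \<in> carrier Gt; e \<in> fibre E z\<rbrakk> \<Longrightarrow> twist g e \<in> fibre E z"
  using fibre_linearD(1)[OF twist_linear] fibre_in_disc[OF E] by blast

lemma twist_self_adjoint:
  assumes g: "g \<in> carrier Gt" and e: "e \<in> fibre E z" and f: "f \<in> fibre E z"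
  shows "herm E (twist g e) f = herm E e (twist g f)"
proof -
  let ?i = "act (inv\<^bsub>Gt\<^esub> g)"
  have i: "?i e \<in> fibre E (move (inv\<^bsub>Gt\<^esub> g) z)" "?i f \<in> fibre E (move (inv\<^bsub>Gt\<^esub> g) z)"
    using act_fibre g e f by auto
  have "herm E (act g (P (?i e))) (act g (?i f)) = herm E (act g (?i e)) (act g (P (?i f)))"
    unfolding act_isometric[OF g P_fibre[OF i(1)] i(2)] act_isometric[OF g i(1) P_fibre[OF i(2)]]
    by (rule P_self_adjoint[OF i])
  then show ?thesis
    using act_inv(2)[OF g] fibre_Total[OF e] fibre_Total[OF f] by (simp add: twist_def)
qed

lemma twist_mult:
  assumes "k \<in> carrier Gt" "g \<in> carrier Gt" "e \<in> Total E"
  shows "twist (k \<otimes>\<^bsub>Gt\<^esub> g) e = act k (twist g (act (inv\<^bsub>Gt\<^esub> k) e))"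
proof -
  have "act (inv\<^bsub>Gt\<^esub> (k \<otimes>\<^bsub>Gt\<^esub> g)) e = act (inv\<^bsub>Gt\<^esub> g) (act (inv\<^bsub>Gt\<^esub> k) e)"
    using act_mult[of "inv\<^bsub>Gt\<^esub> g" "inv\<^bsub>Gt\<^esub> k" e] assms by (simp add: G.inv_mult_group)
  moreover have "P (act (inv\<^bsub>Gt\<^esub> g) (act (inv\<^bsub>Gt\<^esub> k) e)) \<in> Total E"
    using assms by (intro fibre_Total[OF P_fibre[OF Total_in_fibre]] act_Total) auto
  ultimately show ?thesis using act_mult[of k g] assms by (simp add: twist_def)
qed

text \<open>
  The trace of \<open>twist g \<circ> twist h\<close> on the fibre over \<open>z\<close>, which is their inner product in the sense of
  Hilbert and Schmidt. Coordinates are chosen at every point in order to have a function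
  on the whole disc; by \<open>corr_eq\<close> the choice does not affect the value.
\<close>

definition corr :: "'g \<Rightarrow> 'g \<Rightarrow> complex \<Rightarrow> complex" where
  "corr g h z = fibre_trace E z (SOME \<phi>. fibre_coords E z \<phi>) (\<lambda>e. twist g (twist h e))"

lemma corr_eq:
  assumes "fibre_coords E z \<phi>" "z \<in> unit_disc" "g \<in> carrier Gt" "h \<in> carrier Gt"
  shows "corr g h z = fibre_trace E z \<phi> (\<lambda>e. twist g (twist h e))"
  unfolding corr_def
  by (rule fibre_trace_coords_independent[OF E someI[of "fibre_coords E z", OF assms(1)] assms(1)])
    (rule fibre_linear_compose[OF twist_linear[OF assms(4,2)] twist_linear[OF assms(3,2)]])

lemma corr_holomorphic:
  assumes gh: "g \<in> carrier Gt" "h \<in> carrier Gt"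
  shows "corr g h holomorphic_on unit_disc"
proof (rule holomorphic_on_locally)
  fix z0 :: complex assume "z0 \<in> unit_disc"
  then obtain U \<phi> where \<phi>: "(U, \<phi>) \<in> atlas E" "z0 \<in> U" using chart_at[OF E] by metis
  have "holomorphic_bundle_map E E (\<lambda>z. z) (\<lambda>e. twist g (twist h e))"
    by (rule holomorphic_bundle_map_compose[OF E E E twist_holomorphic[OF gh(2)]
          twist_holomorphic[OF gh(1)]])
  from holomorphic_bundle_mapD(4)[OF this \<phi>(1) \<phi>(1)]
  have "(\<lambda>z. \<phi> (twist g (twist h (frame E \<phi> j z))) j) holomorphic_on U" if "j < rk E" for j
    using that by simp
  then have tr: "(\<lambda>z. fibre_trace E z \<phi> (\<lambda>e. twist g (twist h e))) holomorphic_on U"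
    unfolding fibre_trace_def by (intro holomorphic_on_sum) simp
  have "corr g h holomorphic_on U"
    by (rule holomorphic_transform[OF tr])
      (use corr_eq[OF chart_coords[OF E \<phi>(1)] _ gh] chart_subset_disc[OF E \<phi>(1)] in auto)
  then show "\<exists>T. open T \<and> z0 \<in> T \<and> corr g h holomorphic_on T"
    using \<phi> atlas_open by blast
qed

lemma corr_sym:
  assumes z: "z \<in> unit_disc" and gh: "g \<in> carrier Gt" "h \<in> carrier Gt"
  shows "corr g h z = corr h g z"
proof -
  obtain \<phi> where \<phi>: "fibre_coords E z \<phi>" using chart_at[OF E z] by blast
  show ?thesis
    using fibre_trace_commute[OF E E \<phi> \<phi> twist_linear[OF gh(2) z] twist_linear[OF gh(1) z]]
      corr_eq[OF \<phi> z gh] corr_eq[OF \<phi> z gh(2,1)] by simp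
qed

definition entry :: "('e \<Rightarrow> nat \<Rightarrow> complex) \<Rightarrow> complex \<Rightarrow> 'g \<Rightarrow> nat \<times> nat \<Rightarrow> complex" where
  "entry \<psi> z g = (\<lambda>(j, i). \<psi> (twist g (frame E \<psi> j z)) i)"

abbreviation indices :: "(nat \<times> nat) set" where "indices \<equiv> {..<rk E} \<times> {..<rk E}"

text \<open>
  Self-adjointness of \<open>twist g\<close> turns the trace into the standard inner product of matrices.
\<close>

lemma corr_orthonormal:
  assumes \<psi>: "orthonormal_coords E z \<psi>" and z: "z \<in> unit_disc"
    and gh: "g \<in> carrier Gt" "h \<in> carrier Gt"
  shows "corr g h z = (\<Sum>k\<in>indices. entry \<psi> z h k * cnj (entry \<psi> z g k))"
proof -
  have c: "fibre_coords E z \<psi>"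
    and H: "\<And>e f. \<lbrakk>e \<in> fibre E z; f \<in> fibre E z\<rbrakk> \<Longrightarrow> herm E e f = (\<Sum>i<rk E. \<psi> e i * cnj (\<psi> f i))"
    using \<psi> by (auto simp: orthonormal_coords_def)
  have "\<psi> (twist g (twist h (frame E \<psi> j z))) j
      = (\<Sum>i<rk E. entry \<psi> z h (j, i) * cnj (entry \<psi> z g (j, i)))" if j: "j < rk E" for j
  proof -
    let ?b = "frame E \<psi> j z"
    have b: "?b \<in> fibre E z" "\<psi> ?b = unit_vec j" using frame_coords[OF c j] .
    have t: "twist h ?b \<in> fibre E z" "twist g ?b \<in> fibre E z" "twist g (twist h ?b) \<in> fibre E z"
      using twist_fibre gh b(1) by blast+
    have "\<psi> (twist g (twist h ?b)) j = herm E (twist g (twist h ?b)) ?b"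
      unfolding H[OF t(3) b(1)] b(2) using j
      by (simp add: unit_vec_def if_distrib[of cnj] if_distrib[of "(*) _"] cong: if_cong)
    also have "\<dots> = herm E (twist h ?b) (twist g ?b)"
      by (rule twist_self_adjoint[OF gh(1) t(1) b(1)])
    finally show ?thesis by (simp add: H[OF t(1,2)] entry_def)
  qed
  then show ?thesis
    unfolding corr_eq[OF c z gh] fibre_trace_def
    by (simp add: sum.cartesian_product split_def)
qed

text \<open>
  Interchanging the two operators does not change the trace, but by \<open>corr_orthonormal\<close> conjugates it. So
  it is real, and a real holomorphic function is constant.
\<close>

lemma corr_constant:
  assumes z: "z \<in> unit_disc" and gh: "g \<in> carrier Gt" "h \<in> carrier Gt"
  shows "corr g h z = corr g h 0"
proof (rule holomorphic_real_constant[OF corr_holomorphic[OF gh] _ z])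
  fix w :: complex assume w: "w \<in> unit_disc"
  obtain \<psi> where \<psi>: "orthonormal_coords E w \<psi>" using orthonormal_coords_exist[OF E w] .
  have "cnj (corr g h w) = corr h g w"
    unfolding corr_orthonormal[OF \<psi> w gh] corr_orthonormal[OF \<psi> w gh(2,1)]
    by (simp add: mult.commute)
  then show "corr g h w \<in> \<real>"
    using corr_sym[OF w gh] by (metis Reals_cnj_iff)
qed

text \<open>
  Conjugation by \<open>k\<close> identifies the trace at \<open>0\<close> with the trace at \<open>move k 0\<close>; since the latter does not
  depend on the point, it can be moved back to \<open>0\<close>.
\<close>

lemma corr_translate:
  assumes k: "k \<in> carrier Gt" and gh: "g \<in> carrier Gt" "h \<in> carrier Gt"
  shows "corr (k \<otimes>\<^bsub>Gt\<^esub> g) (k \<otimes>\<^bsub>Gt\<^esub> h) 0 = corr g h 0"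
proof -
  let ?w = "move k 0" and ?i = "act (inv\<^bsub>Gt\<^esub> k)"
  have 0: "(0::complex) \<in> unit_disc" by simp
  have w: "?w \<in> unit_disc" using move_disc[OF k 0] .
  obtain \<phi> where \<phi>: "fibre_coords E 0 \<phi>" using chart_at[OF E 0] by blast
  obtain \<psi> where \<psi>: "fibre_coords E ?w \<psi>" using chart_at[OF E w] by blast
  have kgh: "k \<otimes>\<^bsub>Gt\<^esub> g \<in> carrier Gt" "k \<otimes>\<^bsub>Gt\<^esub> h \<in> carrier Gt" using k gh by auto
  have i_lin: "fibre_linear E E ?w 0 ?i"
    using act_linear[of "inv\<^bsub>Gt\<^esub> k" ?w] k w move_inv(2)[OF k 0] by simp
  have X: "fibre_linear E E ?w 0 (\<lambda>e. twist g (twist h (?i e)))"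
    by (rule fibre_linear_compose[OF i_lin
          fibre_linear_compose[OF twist_linear[OF gh(2) 0] twist_linear[OF gh(1) 0]]])
  have Y: "fibre_linear E E 0 ?w (act k)" using act_linear[OF k 0] .
  have "corr (k \<otimes>\<^bsub>Gt\<^esub> g) (k \<otimes>\<^bsub>Gt\<^esub> h) 0 = corr (k \<otimes>\<^bsub>Gt\<^esub> g) (k \<otimes>\<^bsub>Gt\<^esub> h) ?w"
    using corr_constant[OF w kgh] by simp
  also have "\<dots> = fibre_trace E ?w \<psi> (\<lambda>e. twist (k \<otimes>\<^bsub>Gt\<^esub> g) (twist (k \<otimes>\<^bsub>Gt\<^esub> h) e))"
    by (rule corr_eq[OF \<psi> w kgh])
  also have "\<dots> = fibre_trace E ?w \<psi> (\<lambda>e. act k (twist g (twist h (?i e))))"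
  proof (rule fibre_trace_cong[OF \<psi>])
    fix e assume e: "e \<in> fibre E ?w"
    have i: "twist h (?i e) \<in> Total E"
      using twist_fibre[OF gh(2) fibre_linearD(1)[OF i_lin e]] fibre_Total by blast
    show "twist (k \<otimes>\<^bsub>Gt\<^esub> g) (twist (k \<otimes>\<^bsub>Gt\<^esub> h) e) = act k (twist g (twist h (?i e)))"
      using twist_mult[OF k gh(2) fibre_Total[OF e]] twist_mult[OF k gh(1) act_Total[OF k i]]
        act_inv(1)[OF k i] by simp
  qed
  also have "\<dots> = fibre_trace E 0 \<phi> (\<lambda>e. twist g (twist h (?i (act k e))))"
    by (rule fibre_trace_commute[OF E E \<psi> \<phi> X Y])
  also have "\<dots> = fibre_trace E 0 \<phi> (\<lambda>e. twist g (twist h e))"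
    by (rule fibre_trace_cong[OF \<phi>]) (simp add: act_inv(1)[OF k fibre_Total])
  also have "\<dots> = corr g h 0" by (rule corr_eq[OF \<phi> 0 gh, symmetric])
  finally show ?thesis .
qed

text \<open>
  The Hilbert-Schmidt distance of \<open>twist g\<close> and \<open>twist h\<close>, see \<open>gdist_eq\<close>. By \<open>corr_diag\<close> all \<open>twist g\<close>
  have the norm of \<open>P\<close>, so that only the mixed term depends on \<open>g\<close> and \<open>h\<close>.
\<close>

definition gdist :: "'g \<Rightarrow> 'g \<Rightarrow> real" where
  "gdist g h = sqrt (2 * Re (corr \<one>\<^bsub>Gt\<^esub> \<one>\<^bsub>Gt\<^esub> 0) - 2 * Re (corr g h 0))"

lemma gdist_translate:
  assumes "k \<in> carrier Gt" "g \<in> carrier Gt" "h \<in> carrier Gt"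
  shows "gdist (k \<otimes>\<^bsub>Gt\<^esub> g) (k \<otimes>\<^bsub>Gt\<^esub> h) = gdist g h"
  unfolding gdist_def corr_translate[OF assms] ..

lemma corr_diag: "g \<in> carrier Gt \<Longrightarrow> corr g g 0 = corr \<one>\<^bsub>Gt\<^esub> \<one>\<^bsub>Gt\<^esub> 0"
  using corr_translate[of g "\<one>\<^bsub>Gt\<^esub>" "\<one>\<^bsub>Gt\<^esub>"] by simp

lemma gdist_eq:
  assumes \<psi>: "orthonormal_coords E z \<psi>" and z: "z \<in> unit_disc"
    and gh: "g \<in> carrier Gt" "h \<in> carrier Gt"
  shows "gdist g h = L2_set (\<lambda>k. norm (entry \<psi> z g k - entry \<psi> z h k)) indices"
proof -
  let ?a = "entry \<psi> z g" and ?b = "entry \<psi> z h"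
  have sq: "Re (x * cnj x) = (norm x)\<^sup>2" for x :: complex
    by (simp add: cmod_power2) (simp add: power2_eq_square)
  have "(\<Sum>k\<in>indices. (norm (?a k - ?b k))\<^sup>2)
      = (\<Sum>k\<in>indices. Re (?a k * cnj (?a k)) + Re (?b k * cnj (?b k)) - 2 * Re (?b k * cnj (?a k)))"
    by (intro sum.cong refl) (simp add: cmod_power2, simp add: power2_eq_square algebra_simps)
  also have "\<dots> = Re (corr g g z) + Re (corr h h z) - 2 * Re (corr g h z)"
    unfolding corr_orthonormal[OF \<psi> z gh(1,1)] corr_orthonormal[OF \<psi> z gh(2,2)]
      corr_orthonormal[OF \<psi> z gh] Re_sum sum_distrib_left
    by (simp only: sum.distrib sum_subtractf)
  also have "\<dots> = 2 * Re (corr \<one>\<^bsub>Gt\<^esub> \<one>\<^bsub>Gt\<^esub> 0) - 2 * Re (corr g h 0)"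
    unfolding corr_constant[OF z gh(1,1)] corr_constant[OF z gh(2,2)] corr_constant[OF z gh]
      corr_diag[OF gh(1)] corr_diag[OF gh(2)] by simp
  finally show ?thesis
    unfolding gdist_def L2_set_def by simp
qed

lemma gdist_metric:
  assumes "g \<in> carrier Gt" "h \<in> carrier Gt" "k \<in> carrier Gt"
  shows "0 \<le> gdist g h" "gdist g h = gdist h g" "gdist g k \<le> gdist g h + gdist h k"
proof -
  obtain \<psi> where \<psi>: "orthonormal_coords E 0 \<psi>"
    using orthonormal_coords_exist[OF E, of 0] by auto
  note d = gdist_eq[OF \<psi>, simplified]
  show "0 \<le> gdist g h" "gdist g h = gdist h g"
    using assms by (simp_all add: d norm_minus_commute)
  have "gdist g k \<le> L2_set (\<lambda>i. norm (entry \<psi> 0 g i - entry \<psi> 0 h i)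
      + norm (entry \<psi> 0 h i - entry \<psi> 0 k i)) indices"
    unfolding d[OF assms(1,3)]
  proof (rule L2_set_mono)
    fix i
    show "norm (entry \<psi> 0 g i - entry \<psi> 0 k i)
      \<le> norm (entry \<psi> 0 g i - entry \<psi> 0 h i) + norm (entry \<psi> 0 h i - entry \<psi> 0 k i)"
      using norm_triangle_ineq[of "entry \<psi> 0 g i - entry \<psi> 0 h i" "entry \<psi> 0 h i - entry \<psi> 0 k i"]
      by simp
  qed simp
  also have "\<dots> \<le> gdist g h + gdist h k"
    unfolding d[OF assms(1,2)] d[OF assms(2,3)] by (rule L2_set_triangle_ineq)
  finally show "gdist g k \<le> gdist g h + gdist h k" .
qed

lemma gdist_recurrence:
  assumes a: "\<And>n::nat. x n \<in> carrier Gt" and \<epsilon>: "\<epsilon> > 0"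
  shows "\<exists>m n. m < n \<and> gdist (x n) (x m) < \<epsilon>"
proof -
  obtain \<psi> where \<psi>: "orthonormal_coords E 0 \<psi>"
    using orthonormal_coords_exist[OF E, of 0] by auto
  define K where "K = sqrt (Re (corr \<one>\<^bsub>Gt\<^esub> \<one>\<^bsub>Gt\<^esub> 0))"
  have "norm (entry \<psi> 0 (x n) i) \<le> K" if i: "i \<in> indices" for n i
  proof -
    have "norm (entry \<psi> 0 (x n) i) \<le> L2_set (\<lambda>k. norm (entry \<psi> 0 (x n) k)) indices"
      using i by (intro member_le_L2_set) auto
    also have "\<dots> = sqrt (Re (corr (x n) (x n) 0))"
      unfolding corr_orthonormal[OF \<psi> _ a a, simplified] L2_set_def Re_sum
      by (intro arg_cong[of _ _ sqrt] sum.cong refl) (simp add: cmod_power2, simp add: power2_eq_square)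
    finally show ?thesis unfolding K_def corr_diag[OF a] .
  qed
  then show ?thesis
    using bounded_family_recurrence[of indices "\<lambda>n. entry \<psi> 0 (x n)" K \<epsilon>] \<epsilon>
      gdist_eq[OF \<psi> _ a a, simplified] by auto
qed

text \<open>
  The distance may be evaluated in the fibre over any point, so if it vanishes then \<open>twist g\<close> and
  \<open>P\<close> agree in all fibres.
\<close>

lemma gdist_zero_commutes:
  assumes g: "g \<in> carrier Gt" and d: "gdist g \<one>\<^bsub>Gt\<^esub> = 0" and e: "e \<in> Total E"
  shows "act g (P e) = P (act g e)"
proof -
  define z where "z = proj E (act g e)"
  have f: "act g e \<in> fibre E z" unfolding z_def using Total_in_fibre[OF act_Total[OF g e]] .
  have z: "z \<in> unit_disc" using fibre_in_disc[OF E f] .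
  obtain \<psi> where \<psi>: "orthonormal_coords E z \<psi>" using orthonormal_coords_exist[OF E z] .
  then have c: "fibre_coords E z \<psi>" by (simp add: orthonormal_coords_def)
  have "\<forall>k\<in>indices. entry \<psi> z g k = entry \<psi> z \<one>\<^bsub>Gt\<^esub> k"
    using d gdist_eq[OF \<psi> z g G.one_closed] by (simp add: L2_set_eq_0_iff)
  then have eq: "\<psi> (twist g (frame E \<psi> j z)) i = \<psi> (twist \<one>\<^bsub>Gt\<^esub> (frame E \<psi> j z)) i"
    if "j < rk E" "i < rk E" for i j
    using that by (auto simp: entry_def)
  have "\<psi> (twist g (act g e)) i = \<psi> (twist \<one>\<^bsub>Gt\<^esub> (act g e)) i" for i
  proof (cases "i < rk E")
    case True
    then show ?thesis
      using coords_linear_expansion[OF E c c twist_linear[OF g z] f, of i]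
        coords_linear_expansion[OF E c c twist_linear[OF G.one_closed z] f, of i] eq by simp
  next
    case False
    then show ?thesis
      using fibre_coords_zero_beyond[OF c twist_fibre[OF g f]]
        fibre_coords_zero_beyond[OF c twist_fibre[OF G.one_closed f]] by simp
  qed
  then have "twist g (act g e) = twist \<one>\<^bsub>Gt\<^esub> (act g e)"
    by (intro fibre_coords_inj[OF c twist_fibre[OF g f] twist_fibre[OF G.one_closed f]] ext)
  then show ?thesis
    using twist_one[OF act_Total[OF g e]] act_inv(1)[OF g e] by (simp add: twist_def)
qed


text \<open>
  The point at which \<open>g\<close> acts last also depends on \<open>g\<close>, so joint continuity of the action is used.
\<close>

lemma continuous_orbit:
  assumes v: "v \<in> fibre E z" and \<phi>: "(U, \<phi>) \<in> atlas E" "z \<in> U"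
  shows "continuous_on (carrier Gt) (\<lambda>g. \<phi> (twist g v) i)"
proof -
  let ?C = "top_of_set (carrier Gt)" and ?B = "bundle_topology E"
  have act_cont: "continuous_map ?C ?B (\<lambda>g. act (k g) (y g))"
    if "continuous_map ?C ?C k" "continuous_map ?C ?B y" for k y
    using continuous_map_compose[OF continuous_map_pairedI[OF that] act_continuous]
    by (simp add: o_def split_def)
  have inv: "continuous_map ?C ?C (\<lambda>g. inv\<^bsub>Gt\<^esub> g)"
    using continuous_inv by (simp add: continuous_map_in_subtopology continuous_map_iff_continuous
        image_subset_iff)
  have "continuous_map ?C ?B (\<lambda>g. act (inv\<^bsub>Gt\<^esub> g) v)"
    by (rule act_cont[OF inv]) (simp add: topspace_bundle_topology[OF E] fibre_Total[OF v])
  from continuous_map_compose[OF this continuous_holomorphic_bundle_map[OF E E P_holomorphic]]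
  have "continuous_map ?C ?B (\<lambda>g. P (act (inv\<^bsub>Gt\<^esub> g) v))" by (simp add: o_def)
  from act_cont[OF continuous_map_id[unfolded id_def] this]
  have t: "continuous_map ?C ?B (\<lambda>g. twist g v)" by (simp add: twist_def)
  have "continuous_map ?C euclidean (\<lambda>g. \<phi> (twist g v) i)"
    unfolding continuous_map_def
  proof (intro conjI allI impI)
    fix X :: "complex set" assume "openin euclidean X"
    then have "open X" by (simp only: open_openin)
    from openin_continuous_map_preimage[OF t openin_chart_coordinate[OF \<phi>(1) this]]
    have "openin ?C {g \<in> topspace ?C. twist g v \<in> {e \<in> Total E. proj E e \<in> U \<and> \<phi> e i \<in> X}}" .
    moreover have "twist g v \<in> Total E \<and> proj E (twist g v) = z" if "g \<in> carrier Gt" for g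
      using twist_fibre[OF that v] by (simp add: fibre_def)
    then have "{g \<in> topspace ?C. twist g v \<in> {e \<in> Total E. proj E e \<in> U \<and> \<phi> e i \<in> X}}
        = {g \<in> topspace ?C. \<phi> (twist g v) i \<in> X}"
      using \<phi>(2) by auto
    ultimately show "openin ?C {g \<in> topspace ?C. \<phi> (twist g v) i \<in> X}" by simp
  qed simp
  then show ?thesis by (simp add: continuous_map_iff_continuous)
qed

lemma gdist_small_near_one:
  assumes "\<epsilon> > 0"
  shows "\<exists>T. openin (top_of_set (carrier Gt)) T \<and> \<one>\<^bsub>Gt\<^esub> \<in> T \<and> (\<forall>g\<in>T. gdist g \<one>\<^bsub>Gt\<^esub> < \<epsilon>)"
proof -
  have 0: "(0::complex) \<in> unit_disc" by simp
  obtain U \<phi> where \<phi>: "(U, \<phi>) \<in> atlas E" "0 \<in> U" "fibre_coords E 0 \<phi>" using chart_at[OF E 0] .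
  have "continuous_on (carrier Gt) (\<lambda>g. \<Sum>j<rk E. \<phi> (twist g (twist \<one>\<^bsub>Gt\<^esub> (frame E \<phi> j 0))) j)"
    using twist_fibre[OF G.one_closed frame_coords(1)[OF \<phi>(3)]]
    by (intro continuous_on_sum continuous_orbit[OF _ \<phi>(1,2)]) auto
  moreover have "corr g \<one>\<^bsub>Gt\<^esub> 0 = (\<Sum>j<rk E. \<phi> (twist g (twist \<one>\<^bsub>Gt\<^esub> (frame E \<phi> j 0))) j)"
    if "g \<in> carrier Gt" for g
    using corr_eq[OF \<phi>(3) 0 that G.one_closed] by (simp add: fibre_trace_def)
  ultimately have "continuous_on (carrier Gt) (\<lambda>g. corr g \<one>\<^bsub>Gt\<^esub> 0)"
    by (simp cong: continuous_on_cong)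
  then have "continuous_on (carrier Gt) (\<lambda>g. gdist g \<one>\<^bsub>Gt\<^esub>)"
    unfolding gdist_def by (intro continuous_intros)
  from continuous_openin_preimage_gen[OF this open_lessThan[of \<epsilon>]]
  have "openin (top_of_set (carrier Gt)) (carrier Gt \<inter> (\<lambda>g. gdist g \<one>\<^bsub>Gt\<^esub>) -` {..<\<epsilon>})" .
  moreover have "gdist \<one>\<^bsub>Gt\<^esub> \<one>\<^bsub>Gt\<^esub> = 0" by (simp add: gdist_def)
  ultimately show ?thesis using assms by (intro exI[of _ "carrier Gt \<inter> (\<lambda>g. gdist g \<one>\<^bsub>Gt\<^esub>) -` {..<\<epsilon>}"]) simp
qed

text \<open>
  Two powers of \<open>a\<close> that are close to each other have a quotient close to the identity, by left
  invariance.
\<close>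

lemma power_recurrence:
  assumes a: "a \<in> carrier Gt" and \<epsilon>: "\<epsilon> > 0"
  shows "\<exists>n\<ge>(M::nat). gdist (a [^]\<^bsub>Gt\<^esub> n) \<one>\<^bsub>Gt\<^esub> < \<epsilon>"
proof -
  \<comment> \<open>only multiples of \<open>Suc M\<close> occur as exponents, hence so is their difference, which is positive\<close>
  let ?M = "Suc M"
  obtain m n where mn: "m < n" "gdist (a [^]\<^bsub>Gt\<^esub> (n * ?M)) (a [^]\<^bsub>Gt\<^esub> (m * ?M)) < \<epsilon>"
    using gdist_recurrence[of "\<lambda>n. a [^]\<^bsub>Gt\<^esub> (n * ?M)" \<epsilon>] a \<epsilon> by auto
  have "a [^]\<^bsub>Gt\<^esub> (n * ?M) = a [^]\<^bsub>Gt\<^esub> (m * ?M) \<otimes>\<^bsub>Gt\<^esub> a [^]\<^bsub>Gt\<^esub> ((n - m) * ?M)"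
    using mn(1) by (simp only: G.nat_pow_mult[OF a] add_mult_distrib[symmetric]) simp
  then have "gdist (a [^]\<^bsub>Gt\<^esub> ((n - m) * ?M)) \<one>\<^bsub>Gt\<^esub> < \<epsilon>"
    using mn(2) gdist_translate[of "a [^]\<^bsub>Gt\<^esub> (m * ?M)" "a [^]\<^bsub>Gt\<^esub> ((n - m) * ?M)" "\<one>\<^bsub>Gt\<^esub>"] a by simp
  moreover have "(n - m) * ?M \<ge> M"
    using mn(1) by (metis Suc_leD le_add1 mult.commute mult_le_mono2 nat_mult_1_right zero_less_diff less_eq_Suc_le One_nat_def)
  ultimately show ?thesis by blast
qed

text \<open>
  For \<open>b = a\<^sup>n\<close>, left invariance gives
  \<open>d(u, 1) \<le> d(u, u b) + d(u b, b) + d(b, 1) = 2 d(b, 1) + d(b\<^sup>-\<^sup>1 u b, 1)\<close>. The last term is small for all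
  large \<open>n\<close> and the first one for some of them.
\<close>

lemma contracted_gdist_zero:
  assumes a: "a \<in> carrier Gt" and u: "u \<in> carrier Gt" and "contracts a u"
  shows "gdist u \<one>\<^bsub>Gt\<^esub> = 0"
proof -
  have "gdist u \<one>\<^bsub>Gt\<^esub> \<le> 0 + \<epsilon>" if "\<epsilon> > 0" for \<epsilon>
  proof -
    have \<epsilon>: "\<epsilon> / 3 > 0" using that by simp
    obtain T where T: "openin (top_of_set (carrier Gt)) T" "\<one>\<^bsub>Gt\<^esub> \<in> T"
      "\<And>g. g \<in> T \<Longrightarrow> gdist g \<one>\<^bsub>Gt\<^esub> < \<epsilon> / 3"
      using gdist_small_near_one[OF \<epsilon>] by blast
    obtain M where M: "\<And>n::nat. n \<ge> M \<Longrightarrow>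
        inv\<^bsub>Gt\<^esub> (a [^]\<^bsub>Gt\<^esub> n) \<otimes>\<^bsub>Gt\<^esub> u \<otimes>\<^bsub>Gt\<^esub> (a [^]\<^bsub>Gt\<^esub> n) \<in> T"
      using assms(3) T(1,2) unfolding contracts_def by blast
    obtain n where n: "n \<ge> M" "gdist (a [^]\<^bsub>Gt\<^esub> n) \<one>\<^bsub>Gt\<^esub> < \<epsilon> / 3"
      using power_recurrence[OF a \<epsilon>] by blast
    define b where "b = a [^]\<^bsub>Gt\<^esub> n"
    have b: "b \<in> carrier Gt" using a by (simp add: b_def)
    let ?v = "inv\<^bsub>Gt\<^esub> b \<otimes>\<^bsub>Gt\<^esub> u \<otimes>\<^bsub>Gt\<^esub> b"
    have v: "?v \<in> carrier Gt" "gdist ?v \<one>\<^bsub>Gt\<^esub> < \<epsilon> / 3"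
      using b u T(3)[OF M[OF n(1)]] by (simp_all add: b_def)
    have "b \<otimes>\<^bsub>Gt\<^esub> ?v = u \<otimes>\<^bsub>Gt\<^esub> b"
      using b u by (simp add: G.m_assoc[symmetric])
    then have "gdist (u \<otimes>\<^bsub>Gt\<^esub> b) b = gdist ?v \<one>\<^bsub>Gt\<^esub>"
      using gdist_translate[OF b v(1) G.one_closed] b by simp
    moreover have "gdist u (u \<otimes>\<^bsub>Gt\<^esub> b) = gdist b \<one>\<^bsub>Gt\<^esub>"
      using gdist_translate[OF u G.one_closed b] gdist_metric(2)[OF b G.one_closed G.one_closed] u
      by simp
    moreover have "gdist u \<one>\<^bsub>Gt\<^esub> \<le> gdist u (u \<otimes>\<^bsub>Gt\<^esub> b) + gdist (u \<otimes>\<^bsub>Gt\<^esub> b) \<one>\<^bsub>Gt\<^esub>"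
      using u b by (intro gdist_metric(3)) auto
    moreover have "gdist (u \<otimes>\<^bsub>Gt\<^esub> b) \<one>\<^bsub>Gt\<^esub> \<le> gdist (u \<otimes>\<^bsub>Gt\<^esub> b) b + gdist b \<one>\<^bsub>Gt\<^esub>"
      using u b by (intro gdist_metric(3)) auto
    ultimately show ?thesis using v(2) n(2) by (simp add: b_def)
  qed
  then have "gdist u \<one>\<^bsub>Gt\<^esub> \<le> 0" by (rule field_le_epsilon)
  then show ?thesis using gdist_metric(1)[OF u G.one_closed G.one_closed] by simp
qed

theorem endomorphism_commutes_with_action:
  assumes "g \<in> carrier Gt" "e \<in> Total E"
  shows "act g (P e) = P (act g e)"
proof -
  define N where "N = {g \<in> carrier Gt. \<forall>e\<in>Total E. act g (P e) = P (act g e)}"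
  have PT: "P e \<in> Total E" if "e \<in> Total E" for e
    using fibre_Total[OF P_fibre[OF Total_in_fibre[OF that]]] .
  have "subgroup N Gt"
  proof
    show "N \<subseteq> carrier Gt" by (auto simp: N_def)
    show "\<one>\<^bsub>Gt\<^esub> \<in> N" by (simp add: N_def act_one PT)
    show "g \<otimes>\<^bsub>Gt\<^esub> h \<in> N" if "g \<in> N" "h \<in> N" for g h
      using that by (simp add: N_def act_mult PT act_Total)
    show "inv\<^bsub>Gt\<^esub> g \<in> N" if g: "g \<in> N" for g
    proof -
      have gC: "g \<in> carrier Gt" "inv\<^bsub>Gt\<^esub> g \<in> carrier Gt" using g by (auto simp: N_def)
      have "act (inv\<^bsub>Gt\<^esub> g) (P e) = P (act (inv\<^bsub>Gt\<^esub> g) e)" if e: "e \<in> Total E" for e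
      proof -
        have f: "act (inv\<^bsub>Gt\<^esub> g) e \<in> Total E" using act_Total[OF gC(2) e] .
        have "act g (P (act (inv\<^bsub>Gt\<^esub> g) e)) = P (act g (act (inv\<^bsub>Gt\<^esub> g) e))"
          using g f by (simp add: N_def)
        also have "\<dots> = P e" using act_inv(2)[OF gC(1) e] by simp
        finally show ?thesis using act_inv(1)[OF gC(1) PT[OF f]] by simp
      qed
      then show ?thesis using gC by (simp add: N_def)
    qed
  qed
  moreover have "u \<in> N" if "a \<in> carrier Gt" "u \<in> carrier Gt" "contracts a u" for a u
    using gdist_zero_commutes[OF that(2) contracted_gdist_zero[OF that]] that(2) by (simp add: N_def)
  ultimately have "N = carrier Gt" by (rule contracted_elements_generate)
  then show ?thesis using assms by (auto simp: N_def)
qed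

end


section \<open>Summands of a homogeneous bundle\<close>

lemma orthogonal_direct_sum_swap:
  assumes E: "hermitian_holomorphic_bundle E" and s: "orthogonal_direct_sum E E1 E2"
  shows "orthogonal_direct_sum E E2 E1"
  unfolding orthogonal_direct_sum_def
proof (intro conjI ballI)
  interpret orthogonal_splitting E E1 E2
    using E s by (simp add: orthogonal_splitting_def orthogonal_splitting_axioms_def)
  show "hermitian_holomorphic_subbundle E2 E" "hermitian_holomorphic_subbundle E1 E"
    using sub by auto
  fix z :: complex assume z: "z \<in> unit_disc"
  obtain \<phi> where \<phi>: "fibre_coords E z \<phi>" using chart_at[OF E z] by blast
  have comm: "vadd E f e = vadd E e f" if "e \<in> fibre E z" "f \<in> fibre E z" for e f
    by (rule fibre_coords_inj[OF \<phi>])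
      (use that vadd_closed in \<open>auto simp: fibre_coordsD(2)[OF \<phi>] add.commute\<close>)
  have "bij_betw ((\<lambda>(e1, e2). vadd E e1 e2) \<circ> prod.swap) (fibre E2 z \<times> fibre E1 z) (fibre E z)"
    by (rule bij_betw_trans[OF _ sum_bij[OF z]]) (auto simp: bij_betw_def inj_on_def image_iff)
  moreover have "((\<lambda>(e1, e2). vadd E e1 e2) \<circ> prod.swap) x = (\<lambda>(e1, e2). vadd E e1 e2) x"
    if "x \<in> fibre E2 z \<times> fibre E1 z" for x
    using that comm sub1(4) sub2(4) by auto
  ultimately show "bij_betw (\<lambda>(e1, e2). vadd E e1 e2) (fibre E2 z \<times> fibre E1 z) (fibre E z)"
    by (simp cong: bij_betw_cong)
  fix e2 e1 assume e: "e2 \<in> fibre E2 z" "e1 \<in> fibre E1 z"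
  show "herm E e2 e1 = 0"
    using herm_sym[OF sub1(4)[OF e(2)] sub2(4)[OF e(1)]] orthogonal[OF e(2,1)] by simp
qed

text \<open>
  Since the projection commutes with the action, the action on \<open>E1\<close> equals inclusion followed by the
  action on \<open>E\<close> and the projection onto \<open>E1\<close>; both its holomorphy and its continuity are obtained from
  this factorisation.
\<close>

lemma homogeneous_summand:
  assumes Gt: "universal_covering_group_SU11 Gt p" and hom: "homogeneous_bundle Gt p act E"
    and sum: "orthogonal_direct_sum E E1 E2"
  shows "homogeneous_bundle Gt p act E1"
proof -
  interpret homogeneous_bundle Gt p act E by (rule hom)
  interpret orthogonal_splitting E E1 E2
    by unfold_locales (rule sum)
  note E = bundle_E and E1 = sub1(1)
  have PE: "holomorphic_bundle_map E E (\<lambda>z. z) P"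
    by (rule holomorphic_bundle_map_compose[OF E E1 E P_holomorphic sub1(2)])
  interpret endo: self_adjoint_endomorphism Gt p act E P
    using Gt hom PE P_self_adjoint
    by (simp add: self_adjoint_endomorphism_def self_adjoint_endomorphism_axioms_def)
  have E1_Total: "e \<in> Total E1 \<Longrightarrow> e \<in> Total E" for e using sub1(3) by blast
  have P_act: "P (act g e) = act g e" if "g \<in> carrier Gt" "e \<in> Total E1" for g e
    using endo.endomorphism_commutes_with_action[OF that(1) E1_Total[OF that(2)]]
      P_E1[OF Total_in_fibre[OF that(2)]] by simp
  show ?thesis
    unfolding homogeneous_bundle_def homogeneous_bundle_axioms_def
  proof (intro conjI allI impI)
    show "hermitian_holomorphic_bundle E1" by (rule E1)
    show "act \<one>\<^bsub>Gt\<^esub> e = e" if "e \<in> Total E1" for e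
      using act_one E1_Total that by blast
    show "act (g \<otimes>\<^bsub>Gt\<^esub> h) e = act g (act h e)"
      if "g \<in> carrier Gt" "h \<in> carrier Gt" "e \<in> Total E1" for g h e
      using act_mult E1_Total that by blast
    show "holomorphic_bundle_map E1 E1 (disc_action (p g)) (act g)" if g: "g \<in> carrier Gt" for g
    proof -
      have "holomorphic_bundle_map E1 E1 (disc_action (p g)) (\<lambda>e. P (act g e))"
        using holomorphic_bundle_map_compose[OF E1 E E1
            holomorphic_bundle_map_compose[OF E1 E E sub1(2) act_holomorphic[OF g]] P_holomorphic] .
      then show ?thesis
        by (rule holomorphic_bundle_map_cong[OF E1]) (simp_all add: P_act[OF g])
    qed
    then have act_E1: "act g e \<in> fibre E1 (disc_action (p g) z)"
      if "g \<in> carrier Gt" "e \<in> fibre E1 z" for g e z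
      using fibre_linearD(1)[OF holomorphic_bundle_mapD(3)] fibre_in_disc[OF E1] that by metis
    show "herm E1 (act g e) (act g f) = herm E1 e f"
      if g: "g \<in> carrier Gt" and e: "e \<in> fibre E1 z" "f \<in> fibre E1 z" for g e f z
      using sub1(7)[OF act_E1[OF g e(1)] act_E1[OF g e(2)]] sub1(7)[OF e]
        act_isometric[OF g sub1(4)[OF e(1)] sub1(4)[OF e(2)]] by simp
    let ?C = "top_of_set (carrier Gt)"
    have "continuous_map (prod_topology ?C (bundle_topology E1)) (prod_topology ?C (bundle_topology E))
        (\<lambda>x. (fst x, snd x))"
      using continuous_map_compose[OF continuous_map_snd continuous_holomorphic_bundle_map[OF E1 E sub1(2)]]
      by (intro continuous_map_pairedI continuous_map_fst) (simp add: o_def)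
    from continuous_map_compose[OF continuous_map_compose[OF this act_continuous]
        continuous_holomorphic_bundle_map[OF E E1 P_holomorphic]]
    show "continuous_map (prod_topology ?C (bundle_topology E1)) (bundle_topology E1) (\<lambda>(g, e). act g e)"
      by (rule continuous_map_eq) (auto simp: topspace_bundle_topology[OF E1] P_act)
  qed
qed

theorem corollary2p1:
  fixes Gt :: "('g::topological_space) monoid" and p :: "'g \<Rightarrow> complex^2^2"
    and act :: "'g \<Rightarrow> 'e \<Rightarrow> 'e" and E E1 E2 :: "'e vbundle"
  assumes "universal_covering_group_SU11 Gt p"
    and "homogeneous_bundle Gt p act E"
    and "reducible_as E E1 E2"
  shows "homogeneous_bundle Gt p act E1 \<and> homogeneous_bundle Gt p act E2"
proof -
  have E: "hermitian_holomorphic_bundle E"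
    using assms(2) by (simp add: homogeneous_bundle_def)
  have s: "orthogonal_direct_sum E E1 E2" using assms(3) by (simp add: reducible_as_def)
  show ?thesis
    using homogeneous_summand[OF assms(1,2) s]
      homogeneous_summand[OF assms(1,2) orthogonal_direct_sum_swap[OF E s]] by blast
qed

end
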